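(* Let $\sigma_\star>0$, $\beta>0$, $\rho\in[0,1]$, let $f(x)=x^2/2$, and let $\mu_D$ be the semicircle law on $[-\sigma_\star,\sigma_\star]$. Let $R,K$ be the limiting overlap and auto-correlation functions described in the context. Assume $\lambda>\sigma_\star/2$ and set $\tilde\lambda=\lambda+\frac{\sigma_\star^2}{4\lambda}$. If $\beta<1/\sigma_\star^2$, the equation $z=\beta^{-1}\mathcal S(z/2)$ has two real roots ($z$ real, $|z|>2\sigma_\star$). Set $s_\beta$ to be the largest real root of this equation if $\beta<1/\sigma_\star^2$, and $s_\beta=2\sigma_\star$ otherwise. Then: (i) If $2\tilde\lambda<s_\beta$ or $\rho=0$, then $\displaystyle\lim_{t\to\infty}\frac{R(t)^2}{\lambda K(t,t)}=0$. (ii) If $2\tilde\lambda>s_\beta$ and $\rho>0$, then $$\lim_{t\to\infty}\frac{R(t)^2}{\lambda K(t,t)}=\left(1-\frac{\beta^{-1}}{2\lambda\big(\lambda+\frac{\sigma_\star^2}{4\lambda}\big)}\right)\left(1-\frac{\sigma_\star^2}{4\lambda^2}\right).$$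
   Context: The semicircle law on $[-\sigma_\star,\sigma_\star]$ has density $\frac{2}{\pi\sigma_\star^2}\sqrt{\sigma_\star^2-x^2}$ there, and $\mathcal S(z)=\mathbb E_{\sigma\sim\mu_D}\big[\frac1{z-\sigma}\big]$ for real $z\notin[-\sigma_\star,\sigma_\star]$ (equal to $\frac{2}{z+\sqrt{z^2-\sigma_\star^2}}$ for $z>\sigma_\star$). Let $(u,\sigma,Y_0)$ be random with $\sigma\sim\mu_D$ independent of $(u,Y_0)$, $\mathbb E[u^2]=\lambda>0$, $\mathbb E[Y_0^2]=1$, $\mathbb E[uY_0]=\rho\sqrt\lambda$. The functions $R:[0,\infty)\to\mathbb R$ and $K:[0,\infty)^2\to\mathbb R$ are the unique continuous solution of the following system, where $K(t):=K(t,t)$ and $H(s,t):=\exp\{-\int_s^tf'(K(r))\,dr\}$: $$R(t)=H(0,t)\,\mathbb E[e^{\sigma t}Y_0u]+\int_0^tH(s,t)R(s)\,\mathbb E[e^{\sigma(t-s)}u^2]\,ds,$$ \begin{align*} K(t,s)=\;&\beta^{-1}\int_0^{s\wedge t}H(r,t)H(r,s)\,\mathbb E[e^{\sigma(t+s-2r)}]\,dr+H(0,t)H(0,s)\,\mathbb E[e^{\sigma(t+s)}Y_0^2]\\ &+H(0,t)\int_0^sH(r,s)R(r)\,\mathbb E[e^{\sigma(t+s-r)}Y_0u]\,dr+H(0,s)\int_0^tH(r,t)R(r)\,\mathbb E[e^{\sigma(t+s-r)}Y_0u]\,dr\\ &+\int_0^t\int_0^sH(r_1,t)H(r_2,s)R(r_1)R(r_2)\,\mathbb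 E[e^{\sigma(t+s-r_1-r_2)}u^2]\,dr_2\,dr_1. \end{align*} (These are the $N\to\infty$ limits of $R^N(t)=\frac1N\sum_i\sqrt N V^iX_t^i$ and $K^N(t,s)=\frac1N\sum_iX_t^iX_s^i$ for the Langevin diffusion $dX_t=JX_t\,dt-f'(\|X_t\|^2/N)X_t\,dt+\beta^{-1/2}dW_t$, $J=VV^\top+G^\top DG$, with $V$ having i.i.d. $\mathcal N(0,\lambda/N)$ entries, $G$ Haar orthogonal, the empirical law of the diagonal of $D$ converging to $\mu_D$, and an initialization with $\mathbb E[(X_0^i)^2]=1$ and correlation $\rho$ with the spike direction.) *)

theory Defs
  imports "HOL-Probability.Probability"
begin

definition semicircle_law :: "real \<Rightarrow> real measure" where
  "semicircle_law a = density lborel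
     (\<lambda>x. ennreal (2 / (pi * a\<^sup>2) * sqrt (a\<^sup>2 - x\<^sup>2) * indicator {-a..a} x))"

definition stieltjes :: "real measure \<Rightarrow> real \<Rightarrow> real" where
  "stieltjes \<mu> z = (\<integral>x. 1 / (z - x) \<partial>\<mu>)"

(* The bound |z| > 2 a keeps z / 2 away from [-a, a], the support of the semicircle law;
   only there does stieltjes have its intended meaning. *)
definition critical_roots :: "real \<Rightarrow> real \<Rightarrow> real set" where
  "critical_roots a \<beta> =
     {z. \<bar>z\<bar> > 2 * a \<and> z = 1 / \<beta> * stieltjes (semicircle_law a) (z / 2)}"

definition s_crit :: "real \<Rightarrow> real \<Rightarrow> real" where
  "s_crit a \<beta> = (if \<beta> < 1 / a\<^sup>2 then Max (critical_roots a \<beta>) else 2 * a)"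

(* H(s,t); only used for 0 \<le> s \<le> t, so the orientation of the integral plays no role. *)
definition H_kernel :: "(real \<Rightarrow> real) \<Rightarrow> (real \<Rightarrow> real \<Rightarrow> real) \<Rightarrow> real \<Rightarrow> real \<Rightarrow> real" where
  "H_kernel f K s t = exp (- integral {s..t} (\<lambda>r. deriv f (K r r)))"

definition R_equation ::
  "'a measure \<Rightarrow> ('a \<Rightarrow> real) \<Rightarrow> ('a \<Rightarrow> real) \<Rightarrow> ('a \<Rightarrow> real) \<Rightarrow> (real \<Rightarrow> real) \<Rightarrow>
   (real \<Rightarrow> real) \<Rightarrow> (real \<Rightarrow> real \<Rightarrow> real) \<Rightarrow> bool" where
  "R_equation M u \<sigma> Y0 f R K \<longleftrightarrow>
    (let H = H_kernel f K in
     \<forall>t\<ge>0. R t =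
        H 0 t * (\<integral>\<omega>. exp (\<sigma> \<omega> * t) * Y0 \<omega> * u \<omega> \<partial>M)
      + integral {0..t} (\<lambda>s. H s t * R s * (\<integral>\<omega>. exp (\<sigma> \<omega> * (t - s)) * (u \<omega>)\<^sup>2 \<partial>M)))"

definition K_equation ::
  "'a measure \<Rightarrow> ('a \<Rightarrow> real) \<Rightarrow> ('a \<Rightarrow> real) \<Rightarrow> ('a \<Rightarrow> real) \<Rightarrow> (real \<Rightarrow> real) \<Rightarrow> real \<Rightarrow>
   (real \<Rightarrow> real) \<Rightarrow> (real \<Rightarrow> real \<Rightarrow> real) \<Rightarrow> bool" where
  "K_equation M u \<sigma> Y0 f \<beta> R K \<longleftrightarrow>
    (let H = H_kernel f K in
     \<forall>t\<ge>0. \<forall>s\<ge>0. K t s =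
        1 / \<beta> * integral {0..min s t}
          (\<lambda>r. H r t * H r s * (\<integral>\<omega>. exp (\<sigma> \<omega> * (t + s - 2 * r)) \<partial>M))
      + H 0 t * H 0 s * (\<integral>\<omega>. exp (\<sigma> \<omega> * (t + s)) * (Y0 \<omega>)\<^sup>2 \<partial>M)
      + H 0 t * integral {0..s}
          (\<lambda>r. H r s * R r * (\<integral>\<omega>. exp (\<sigma> \<omega> * (t + s - r)) * Y0 \<omega> * u \<omega> \<partial>M))
      + H 0 s * integral {0..t}
          (\<lambda>r. H r t * R r * (\<integral>\<omega>. exp (\<sigma> \<omega> * (t + s - r)) * Y0 \<omega> * u \<omega> \<partial>M))
      + integral {0..t} (\<lambda>r1. integral {0..s} (\<lambda>r2.
          H r1 t * H r2 s * R r1 * R r2 *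
          (\<integral>\<omega>. exp (\<sigma> \<omega> * (t + s - r1 - r2)) * (u \<omega>)\<^sup>2 \<partial>M))))"

definition limit_dynamics ::
  "'a measure \<Rightarrow> ('a \<Rightarrow> real) \<Rightarrow> ('a \<Rightarrow> real) \<Rightarrow> ('a \<Rightarrow> real) \<Rightarrow> (real \<Rightarrow> real) \<Rightarrow> real \<Rightarrow>
   (real \<Rightarrow> real) \<Rightarrow> (real \<Rightarrow> real \<Rightarrow> real) \<Rightarrow> bool" where
  "limit_dynamics M u \<sigma> Y0 f \<beta> R K \<longleftrightarrow>
     continuous_on {0..} R \<and>
     continuous_on ({0..} \<times> {0..}) (\<lambda>(t, s). K t s) \<and>
     R_equation M u \<sigma> Y0 f R K \<and> K_equation M u \<sigma> Y0 f \<beta> R K"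

end

theory Submission
  imports Defs
begin

text \<open>
  Write \<open>E\<close> for the mean under the semicircle law on \<open>[-a, a]\<close>, \<open>m(t) = E (exp (x t))\<close>, and \<open>b\<close> for the
  number called \<open>lamt\<close> in the theorem. Since \<open>f'(x) = x\<close>, dividing by
  \<open>h(t) = exp(- \<integral> K(s,s) ds over [0,t])\<close> makes the system linear. With \<open>r = R/h\<close>,
  \<open>k(t) = K(t,t)/h(t)\<^sup>2\<close> and \<open>p = 1/h\<^sup>2\<close>, the first equation becomes the renewal equation
  \<open>r = \<rho> sqrt(lam) m + lam (r * m)\<close>, the second one expresses \<open>k\<close> through \<open>p\<close> and \<open>r\<close>, and
  \<open>p' = 2 k\<close> closes the system. The ratio of the theorem is \<open>r\<^sup>2/(lam k)\<close>.

  The equation for \<open>r\<close> describes the flow of the self-adjoint operator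
  \<open>J g (x) = x g(x) + lam (E g)\<close> on \<open>L\<^sup>2\<close> of the semicircle law, started at a constant \<open>g\<close>; indeed
  \<open>r(t)\<close> is the mean of that flow. As \<open>E (1/(b - x)) = 1/lam\<close>, the function \<open>1/(b - x)\<close> is an
  eigenfunction of \<open>J\<close> with eigenvalue \<open>b > a\<close>, and on its orthogonal complement \<open>b - J\<close> is bounded
  below by a positive constant (lemma \<open>spectral_gap\<close>). Hence, after multiplication by \<open>exp(-b t)\<close>,
  the flow converges exponentially fast to the eigenfunction; this energy estimate gives the limits of
  \<open>exp(-b t) r(t)\<close> and of the noiseless part of \<open>exp(-2 b t) k(t)\<close> (lemmas \<open>overlap_limit\<close> and
  \<open>source_limit\<close>). The semicircle law enters these limits only through
  \<open>E (1/(z - x)) = 1/y\<close> and \<open>E (1/(z - x)\<^sup>2) = 1/(y\<^sup>2 - a\<^sup>2/4)\<close> for \<open>z = y + a\<^sup>2/(4y)\<close>, \<open>y > a/2\<close>.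

  Integrating \<open>p' = 2 k\<close> by parts in the second equation turns it into a renewal equation for
  \<open>exp(-2 b t) k(t)\<close> whose nonnegative kernel has total mass \<open>\<theta> = (1/\<beta>)/(2 lam b)\<close>. If \<open>\<theta> < 1\<close>, the
  solution converges to the limit of the forcing term divided by \<open>1 - \<theta>\<close> (lemma
  \<open>volterra_subcritical\<close>), which yields the formula of the theorem. If \<open>\<theta> > 1\<close>, it tends to infinity (lemma
  \<open>volterra_supercritical\<close>), and the ratio vanishes. Parametrising \<open>z/2 = y + a\<^sup>2/(4y)\<close>
  solves the equation for the critical roots in closed form and shows that \<open>\<theta>\<close> compares with \<open>1\<close>
  exactly as \<open>s_crit\<close> compares with \<open>2 b\<close> (lemma \<open>s_crit_compare\<close>). Finally, if \<open>\<rho> = 0\<close>, the flow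
  starts at \<open>0\<close>, so that \<open>r\<close> vanishes.
\<close>

section \<open>The semicircle law as a weight on an interval\<close>

definition sc_density :: "real \<Rightarrow> real \<Rightarrow> real" where
  "sc_density a x = 2 / (pi * a\<^sup>2) * sqrt (a\<^sup>2 - x\<^sup>2)"

text \<open>
  The expectation under the semicircle law, written as a gauge integral over \<open>[-a, a]\<close>: for continuous
  integrands this makes parameter continuity, differentiation under the integral and the exchange of
  integrals instances of the corresponding facts for compact boxes.
\<close>
definition sc_mean :: "real \<Rightarrow> (real \<Rightarrow> real) \<Rightarrow> real" where
  "sc_mean a \<phi> = integral {-a..a} (\<lambda>x. sc_density a x * \<phi> x)"

lemma sc_density_nonneg: "x \<in> {-a..a} \<Longrightarrow> 0 \<le> sc_density a x"
proof -
  assume "x \<in> {-a..a}"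
  hence "x\<^sup>2 \<le> a\<^sup>2" by (intro abs_le_square_iff[THEN iffD1]) auto
  thus ?thesis by (auto simp: sc_density_def intro!: divide_nonneg_nonneg mult_nonneg_nonneg)
qed

lemma continuous_on_sc_density [continuous_intros]:
  "continuous_on S g \<Longrightarrow> continuous_on S (\<lambda>z. sc_density a (g z))"
  unfolding sc_density_def by (intro continuous_intros)

lemma sc_mean_integrable:
  "continuous_on {-a..a} \<phi> \<Longrightarrow> (\<lambda>x. sc_density a x * \<phi> x) integrable_on {-a..a}"
  by (intro integrable_continuous_real continuous_intros)

lemma sc_mean_cong: "(\<And>x. x \<in> {-a..a} \<Longrightarrow> \<phi> x = \<psi> x) \<Longrightarrow> sc_mean a \<phi> = sc_mean a \<psi>"
  unfolding sc_mean_def by (intro integral_cong) auto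

lemma sc_mean_add:
  assumes "continuous_on {-a..a} \<phi>" "continuous_on {-a..a} \<psi>"
  shows "sc_mean a (\<lambda>x. \<phi> x + \<psi> x) = sc_mean a \<phi> + sc_mean a \<psi>"
  using Henstock_Kurzweil_Integration.integral_add[OF assms[THEN sc_mean_integrable]]
  by (simp add: sc_mean_def algebra_simps)

lemma sc_mean_diff:
  assumes "continuous_on {-a..a} \<phi>" "continuous_on {-a..a} \<psi>"
  shows "sc_mean a (\<lambda>x. \<phi> x - \<psi> x) = sc_mean a \<phi> - sc_mean a \<psi>"
  using Henstock_Kurzweil_Integration.integral_diff[OF assms[THEN sc_mean_integrable]]
  by (simp add: sc_mean_def algebra_simps)

lemma sc_mean_cmult: "sc_mean a (\<lambda>x. c * \<phi> x) = c * sc_mean a \<phi>"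
  unfolding sc_mean_def by (simp flip: integral_mult_right add: algebra_simps)

lemma sc_mean_lincomb:
  assumes "continuous_on {-a..a} \<phi>" "continuous_on {-a..a} \<psi>" "continuous_on {-a..a} \<theta>"
  shows "sc_mean a (\<lambda>x. c * \<phi> x + d * \<psi> x + e * \<theta> x) =
    c * sc_mean a \<phi> + d * sc_mean a \<psi> + e * sc_mean a \<theta>"
proof -
  have c: "continuous_on {-a..a} (\<lambda>x. k * f x)" if "continuous_on {-a..a} f" for k and f :: "real \<Rightarrow> real"
    using that by (intro continuous_on_mult continuous_on_const)
  show ?thesis
    using sc_mean_add[OF continuous_on_add[OF c c] c, OF assms, of c d e]
      sc_mean_add[OF c c, OF assms(1,2), of c d]
    by (simp add: sc_mean_cmult)
qed

lemma sc_mean_mono: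
  assumes "continuous_on {-a..a} \<phi>" "continuous_on {-a..a} \<psi>"
    and "\<And>x. x \<in> {-a..a} \<Longrightarrow> \<phi> x \<le> \<psi> x"
  shows "sc_mean a \<phi> \<le> sc_mean a \<psi>"
  unfolding sc_mean_def
  by (intro integral_le sc_mean_integrable assms mult_left_mono sc_density_nonneg)

lemma sc_mean_nonneg:
  assumes "continuous_on {-a..a} \<phi>" "\<And>x. x \<in> {-a..a} \<Longrightarrow> 0 \<le> \<phi> x"
  shows "0 \<le> sc_mean a \<phi>"
  unfolding sc_mean_def
  by (intro integral_nonneg sc_mean_integrable assms mult_nonneg_nonneg sc_density_nonneg)

lemma sc_mean_swap:
  fixes t :: real
  assumes "continuous_on ({0..t} \<times> {-a..a}) (\<lambda>(s, x). \<phi> s x)"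
  shows "integral {0..t} (\<lambda>s. sc_mean a (\<phi> s)) = sc_mean a (\<lambda>x. integral {0..t} (\<lambda>s. \<phi> s x))"
proof -
  have "continuous_on (cbox (0, -a) (t, a)) (\<lambda>(s, x). sc_density a x * \<phi> s x)"
    using assms unfolding cbox_Pair_eq box_real case_prod_unfold
    by (intro continuous_on_mult continuous_intros)
  from integral_swap_continuous[OF this] show ?thesis
    by (simp add: sc_mean_def cbox_interval flip: integral_mult_right)
qed

lemma continuous_on_sc_mean:
  assumes "continuous_on (U \<times> {-a..a}) (\<lambda>(t, x). \<phi> t x)"
  shows "continuous_on U (\<lambda>t. sc_mean a (\<phi> t))"
  unfolding sc_mean_def cbox_interval[symmetric]
  using assms unfolding case_prod_unfold
  by (intro integral_continuous_on_param, unfold case_prod_unfold cbox_interval)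
    (intro continuous_on_mult continuous_intros)

lemma has_derivative_sc_mean:
  assumes "\<And>t x. t \<in> U \<Longrightarrow> x \<in> {-a..a} \<Longrightarrow> ((\<lambda>t. \<phi> t x) has_real_derivative \<phi>' t x) (at t within U)"
    and "\<And>t. t \<in> U \<Longrightarrow> continuous_on {-a..a} (\<phi> t)"
    and "continuous_on (U \<times> {-a..a}) (\<lambda>(t, x). \<phi>' t x)"
    and "t0 \<in> U" "convex U"
  shows "((\<lambda>t. sc_mean a (\<phi> t)) has_real_derivative sc_mean a (\<phi>' t0)) (at t0 within U)"
  unfolding sc_mean_def cbox_interval[symmetric]
proof (rule leibniz_rule_field_derivative)
  show "continuous_on (U \<times> cbox (- a) a) (\<lambda>(t, x). sc_density a x * \<phi>' t x)"
    using assms(3) unfolding case_prod_unfold cbox_interval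
    by (intro continuous_on_mult continuous_intros)
qed (use assms in \<open>auto intro!: sc_mean_integrable DERIV_cmult simp: cbox_interval\<close>)

lemma integral_semicircle_law:
  assumes [measurable]: "\<phi> \<in> borel_measurable borel" and cont: "continuous_on {-a..a} \<phi>"
  shows "(\<integral>x. \<phi> x \<partial>semicircle_law a) = sc_mean a \<phi>"
proof -
  have "(\<integral>x. \<phi> x \<partial>semicircle_law a)
      = (\<integral>x. (2 / (pi * a\<^sup>2) * sqrt (a\<^sup>2 - x\<^sup>2) * indicator {-a..a} x) *\<^sub>R \<phi> x \<partial>lborel)"
    unfolding semicircle_law_def
  proof (rule integral_density)
    have "0 \<le> 2 / (pi * a\<^sup>2) * sqrt (a\<^sup>2 - x\<^sup>2) * indicator {-a..a} x" for x
      using sc_density_nonneg[of x a] by (auto simp: sc_density_def indicator_def)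
    thus "AE x in lborel. 0 \<le> 2 / (pi * a\<^sup>2) * sqrt (a\<^sup>2 - x\<^sup>2) * indicator {-a..a} x" by simp
  qed auto
  also have "\<dots> = (LINT x:{-a..a}|lborel. sc_density a x * \<phi> x)"
    unfolding set_lebesgue_integral_def by (simp add: sc_density_def mult_ac)
  also have "\<dots> = sc_mean a \<phi>"
    unfolding sc_mean_def
    by (intro set_borel_integral_eq_integral borel_integrable_compact[unfolded set_integrable_def[symmetric]]
        continuous_intros cont) (auto simp: set_integrable_def intro!: borel_integrable_compact continuous_intros cont)
  finally show ?thesis .
qed

lemma integrable_semicircle_law:
  fixes \<phi> :: "real \<Rightarrow> real"
  assumes [measurable]: "\<phi> \<in> borel_measurable borel" and cont: "continuous_on {-a..a} \<phi>"
  shows "integrable (semicircle_law a) \<phi>"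
proof -
  have "0 \<le> 2 / (pi * a\<^sup>2) * sqrt (a\<^sup>2 - x\<^sup>2) * indicator {-a..a} x" for x
    using sc_density_nonneg[of x a] by (auto simp: sc_density_def indicator_def)
  moreover have "set_integrable lborel {-a..a} (\<lambda>x. sc_density a x * \<phi> x)"
    unfolding set_integrable_def by (intro borel_integrable_compact continuous_intros cont) auto
  ultimately show ?thesis
    unfolding semicircle_law_def set_integrable_def
    by (subst integrable_density) (auto simp: sc_density_def mult_ac)
qed

section \<open>The Stieltjes transform of the semicircle law\<close>

text \<open>
  The substitution \<open>z = y + a\<^sup>2/(4y)\<close> maps \<open>(a/2, \<infinity>)\<close> bijectively and increasingly onto \<open>(a, \<infinity>)\<close>. It
  removes all square roots from the Stieltjes transform, because \<open>sqrt(z\<^sup>2 - a\<^sup>2) = y - a\<^sup>2/(4y)\<close>.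
\<close>
lemma joukowski_gt:
  fixes a y :: real
  assumes "0 < a" "a / 2 < y"
  shows "a < y + a\<^sup>2 / (4 * y)"
proof -
  have y: "y > 0" using assms by simp
  have "0 < (2 * y - a)\<^sup>2" using assms by simp
  hence "4 * a * y < 4 * y\<^sup>2 + a\<^sup>2" by (simp add: power2_eq_square algebra_simps)
  thus ?thesis using y by (simp add: field_simps power2_eq_square)
qed

text \<open>
  By the fundamental theorem of calculus, from the primitive
  \<open>- s + z arcsin(x/a) - d arcsin(w(x))\<close> of \<open>s/(z - x)\<close>, where \<open>s = sqrt(a\<^sup>2 - x\<^sup>2)\<close>, \<open>d = sqrt(z\<^sup>2 - a\<^sup>2)\<close> and \<open>w\<close> is
  the Moebius map with pole \<open>z\<close> that is increasing on \<open>[-a, a]\<close> with boundary values \<open>-1\<close> and \<open>1\<close>.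
\<close>
lemma sc_mean_resolvent:
  assumes a: "0 < a" and y: "a / 2 < y" and z: "z = y + a\<^sup>2 / (4 * y)"
  shows "sc_mean a (\<lambda>x. 1 / (z - x)) = 1 / y"
proof -
  have y0: "y > 0" using a y by simp
  have za: "z > a" using joukowski_gt[OF a y] z by simp
  define d where "d = y - a\<^sup>2 / (4 * y)"
  have "a\<^sup>2 < (2 * y)\<^sup>2" using a y by (intro power_strict_mono) auto
  hence d0: "d > 0" using y0 by (simp add: d_def field_simps power2_eq_square)
  have d2: "d\<^sup>2 = z\<^sup>2 - a\<^sup>2" using y0 by (simp add: d_def z field_simps power2_eq_square)
  define w where "w x = (z * x - a\<^sup>2) / (a * (z - x))" for x
  define C where "C = 2 / (pi * a\<^sup>2)"
  define F where "F x = C * (- sqrt (a\<^sup>2 - x\<^sup>2) + z * arcsin (x / a) - d * arcsin (w x))" for x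
  have w1: "1 - (w x)\<^sup>2 = d\<^sup>2 * (a\<^sup>2 - x\<^sup>2) / (a * (z - x))\<^sup>2" if "x \<in> {-a..a}" for x
  proof -
    have "a * (z - x) \<noteq> 0" using a za that by auto
    hence "1 - (w x)\<^sup>2 = ((a * (z - x))\<^sup>2 - (z * x - a\<^sup>2)\<^sup>2) / (a * (z - x))\<^sup>2"
      by (subst diff_divide_distrib) (simp add: w_def power_divide)
    also have "(a * (z - x))\<^sup>2 - (z * x - a\<^sup>2)\<^sup>2 = d\<^sup>2 * (a\<^sup>2 - x\<^sup>2)"
      unfolding d2 by algebra
    finally show ?thesis .
  qed
  have xa: "x\<^sup>2 \<le> a\<^sup>2" if "x \<in> {-a..a}" for x
    using that by (intro abs_le_square_iff[THEN iffD1]) auto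
  have wle: "\<bar>w x\<bar> \<le> 1" if "x \<in> {-a..a}" for x
  proof -
    have "0 \<le> 1 - (w x)\<^sup>2" unfolding w1[OF that] using xa[OF that] by simp
    thus ?thesis by (simp add: abs_square_le_1)
  qed
  have cont: "continuous_on {-a..a} F"
    unfolding F_def
  proof (intro continuous_intros)
    show "continuous_on {- a..a} w" unfolding w_def using a za by (intro continuous_intros) auto
  qed (use a wle in \<open>auto simp: abs_le_iff field_simps\<close>)
  have "((\<lambda>x. sc_density a x * (1 / (z - x))) has_integral (F a - F (-a))) {-a..a}"
  proof (rule fundamental_theorem_of_calculus_interior[OF _ cont])
    fix x assume x: "x \<in> {-a<..<a}"
    have zx: "z - x > 0" using x za by auto
    have x2: "a\<^sup>2 - x\<^sup>2 > 0"
    proof -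
      have "\<bar>x\<bar> < a" using x by auto
      hence "x\<^sup>2 < a\<^sup>2" using power_strict_mono[of "\<bar>x\<bar>" a 2] by simp
      thus ?thesis by simp
    qed
    define s where "s = sqrt (a\<^sup>2 - x\<^sup>2)"
    have s0: "s > 0" and s2: "s\<^sup>2 = a\<^sup>2 - x\<^sup>2" using x2 by (auto simp: s_def)
    have sw: "sqrt (1 - (w x)\<^sup>2) = d * s / (a * (z - x))"
      using w1[of x] x a zx d0 by (simp add: real_sqrt_divide real_sqrt_mult s_def)
    hence "sqrt (1 - (w x)\<^sup>2) > 0" using d0 s0 a zx by simp
    hence "(w x)\<^sup>2 < 1" by simp
    hence "\<bar>w x\<bar> < 1" by (simp add: abs_square_less_1)
    hence wb: "-1 < w x" "w x < 1" by auto
    have sx: "sqrt (1 - (x / a)\<^sup>2) = s / a"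
    proof -
      have "1 - (x / a)\<^sup>2 = (a\<^sup>2 - x\<^sup>2) / a\<^sup>2" using a by (simp add: power_divide diff_divide_distrib)
      thus ?thesis using a by (simp add: real_sqrt_divide s_def)
    qed
    have xb: "-1 < x / a" "x / a < 1" using x a by (auto simp: field_simps)
    have dw: "(w has_real_derivative (d\<^sup>2 / (a * (z - x)\<^sup>2))) (at x)"
    proof -
      have "(w has_real_derivative ((z * (a * (z - x)) - (z * x - a\<^sup>2) * (- a)) / (a * (z - x))\<^sup>2)) (at x)"
        unfolding w_def using zx a
        by (auto intro!: derivative_eq_intros simp: power2_eq_square)
      also have "z * (a * (z - x)) - (z * x - a\<^sup>2) * (- a) = a * d\<^sup>2"
        unfolding d2 by (simp add: algebra_simps power2_eq_square)
      finally show ?thesis using a by (simp add: power_mult_distrib power2_eq_square mult_ac)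
    qed
    have ds: "((\<lambda>x. sqrt (a\<^sup>2 - x\<^sup>2)) has_real_derivative (- x / s)) (at x)"
      using x2 by (auto intro!: derivative_eq_intros simp: s_def divide_simps)
    have d1: "((\<lambda>x. arcsin (x / a)) has_real_derivative (1 / s)) (at x)"
      using DERIV_chain2[OF DERIV_arcsin[OF xb] DERIV_cdivide[OF DERIV_ident]] a
      by (simp add: sx)
    have d3: "((\<lambda>x. arcsin (w x)) has_real_derivative (d / ((z - x) * s))) (at x)"
    proof (rule DERIV_chain2[OF DERIV_arcsin[OF wb] dw, THEN DERIV_cong])
      show "inverse (sqrt (1 - (w x)\<^sup>2)) * (d\<^sup>2 / (a * (z - x)\<^sup>2)) = d / ((z - x) * s)"
        unfolding sw using a zx s0 d0 by (simp add: power2_eq_square)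
    qed
    have "(F has_real_derivative C * (x / s + z * (1 / s) - d * (d / ((z - x) * s)))) (at x)"
      unfolding F_def
      by (rule derivative_eq_intros ds d1 d3 refl | simp)+
    also have "x / s + z * (1 / s) - d * (d / ((z - x) * s)) = ((z + x) * (z - x) - d\<^sup>2) / ((z - x) * s)"
      using zx s0 by (simp add: field_simps power2_eq_square)
    also have "(z + x) * (z - x) - d\<^sup>2 = s\<^sup>2" unfolding d2 s2 by algebra
    also have "C * (s\<^sup>2 / ((z - x) * s)) = C * s * (1 / (z - x))"
      using s0 by (simp add: power2_eq_square)
    also have "C * s = sc_density a x" by (simp only: C_def s_def sc_density_def)
    finally show "(F has_vector_derivative sc_density a x * (1 / (z - x))) (at x)"
      by (simp add: has_real_derivative_iff_has_vector_derivative)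
  qed (use a in simp)
  hence "sc_mean a (\<lambda>x. 1 / (z - x)) = F a - F (-a)"
    unfolding sc_mean_def by (rule integral_unique)
  also have "w a = 1" using a za by (simp add: w_def field_simps power2_eq_square)
  hence "F a = C * (z * (pi / 2) - d * (pi / 2))" using a by (simp add: F_def)
  also have "z * (- a) - a\<^sup>2 = - (a * (z - - a))" by (simp add: algebra_simps power2_eq_square)
  hence "w (-a) = -1" using a za by (simp add: w_def)
  hence "F (-a) = - C * (z * (pi / 2) - d * (pi / 2))" using a by (simp add: F_def algebra_simps)
  also have "C * (z * (pi / 2) - d * (pi / 2)) - (- C * (z * (pi / 2) - d * (pi / 2))) = C * pi * (z - d)"
    by (simp add: algebra_simps)
  also have "\<dots> = 1 / y" using a y0 by (simp add: z d_def C_def field_simps power2_eq_square)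
  finally show ?thesis .
qed

text \<open>
  Differentiate \<open>E (1/(z(y) - x)) = 1/y\<close> in \<open>y\<close> rather than in \<open>z\<close>: the chain rule contributes the
  factor \<open>1 - a\<^sup>2/(4y\<^sup>2)\<close>, and both sides stay rational.
\<close>
lemma sc_mean_resolvent_sq:
  assumes a: "0 < a" and y: "a / 2 < y" and z: "z = y + a\<^sup>2 / (4 * y)"
  shows "sc_mean a (\<lambda>x. 1 / (z - x)\<^sup>2) = 1 / (y\<^sup>2 - a\<^sup>2 / 4)"
proof -
  define Z where "Z y = y + a\<^sup>2 / (4 * y)" for y :: real
  have Zx: "Z t - x > 0" if "a / 2 < t" "x \<in> {-a..a}" for t x
    using joukowski_gt[OF a that(1)] that(2) by (auto simp: Z_def)
  have "((\<lambda>t. sc_mean a (\<lambda>x. 1 / (Z t - x))) has_real_derivative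
      sc_mean a (\<lambda>x. - (1 - a\<^sup>2 / (4 * y\<^sup>2)) / (Z y - x)\<^sup>2)) (at y within {a / 2<..})"
  proof (rule has_derivative_sc_mean)
    fix t x assume t: "t \<in> {a / 2<..}" and x: "x \<in> {-a..a}"
    have "Z t - x \<noteq> 0" "t > 0" using Zx[of t x] t x a by auto
    thus "((\<lambda>t. 1 / (Z t - x)) has_real_derivative - (1 - a\<^sup>2 / (4 * t\<^sup>2)) / (Z t - x)\<^sup>2)
        (at t within {a / 2<..})"
      unfolding Z_def by (auto intro!: derivative_eq_intros simp: power2_eq_square)
  next
    fix t assume "t \<in> {a / 2<..}"
    thus "continuous_on {-a..a} (\<lambda>x. 1 / (Z t - x))"
      using Zx[of t] by (intro continuous_intros) force
  next
    show "continuous_on ({a / 2<..} \<times> {- a..a}) (\<lambda>(t, x). - (1 - a\<^sup>2 / (4 * t\<^sup>2)) / (Z t - x)\<^sup>2)"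
      using Zx a unfolding Z_def case_prod_unfold by (intro continuous_intros) force+
  qed (use y in auto)
  moreover have "((\<lambda>t. sc_mean a (\<lambda>x. 1 / (Z t - x))) has_real_derivative - 1 / y\<^sup>2) (at y within {a / 2<..})"
  proof (rule has_field_derivative_transform_within[OF _ zero_less_one])
    show "((\<lambda>t. 1 / t) has_real_derivative - 1 / y\<^sup>2) (at y within {a / 2<..})"
      using a y by (auto intro!: derivative_eq_intros simp: power2_eq_square)
    fix t assume "t \<in> {a / 2<..}"
    thus "1 / t = sc_mean a (\<lambda>x. 1 / (Z t - x))"
      by (intro sc_mean_resolvent[symmetric] a) (auto simp: Z_def)
  qed (use y in auto)
  ultimately have "sc_mean a (\<lambda>x. - (1 - a\<^sup>2 / (4 * y\<^sup>2)) / (Z y - x)\<^sup>2) = - 1 / y\<^sup>2"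
    using y by (intro DERIV_unique[of "\<lambda>t. sc_mean a (\<lambda>x. 1 / (Z t - x))" _ y])
      (simp_all only: at_within_open[OF _ open_greaterThan] greaterThan_iff)
  hence "(1 - a\<^sup>2 / (4 * y\<^sup>2)) * sc_mean a (\<lambda>x. 1 / (z - x)\<^sup>2) = 1 / y\<^sup>2"
    using sc_mean_cmult[of a "- (1 - a\<^sup>2 / (4 * y\<^sup>2))" "\<lambda>x. 1 / (z - x)\<^sup>2"]
    by (simp add: z Z_def algebra_simps)
  moreover have "y > 0" "a\<^sup>2 / 4 < y\<^sup>2"
    using a y power_strict_mono[of "a / 2" y 2] by (auto simp: power_divide)
  moreover define X where "X = sc_mean a (\<lambda>x. 1 / (z - x)\<^sup>2)"
  ultimately have "(1 - a\<^sup>2 / (4 * y\<^sup>2)) * X = 1 / y\<^sup>2" "y > 0" "a\<^sup>2 / 4 < y\<^sup>2" by auto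
  moreover from this have "(y\<^sup>2 - a\<^sup>2 / 4) * X = y\<^sup>2 * ((1 - a\<^sup>2 / (4 * y\<^sup>2)) * X)"
    by (simp add: field_simps)
  ultimately have "(y\<^sup>2 - a\<^sup>2 / 4) * X = 1" by simp
  thus ?thesis using \<open>a\<^sup>2 / 4 < y\<^sup>2\<close> by (simp add: X_def eq_divide_eq mult.commute)
qed

lemma joukowski_surj:
  fixes a z :: real
  assumes a: "0 < a" and z: "a < z"
  obtains y where "a / 2 < y" "z = y + a\<^sup>2 / (4 * y)"
proof
  define d where "d = sqrt (z\<^sup>2 - a\<^sup>2)"
  have "a\<^sup>2 < z\<^sup>2" using a z by (intro power_strict_mono) auto
  hence d: "0 < d" "d\<^sup>2 = z\<^sup>2 - a\<^sup>2" by (auto simp: d_def)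
  show "a / 2 < (z + d) / 2" using z d by simp
  have "a\<^sup>2 = (z + d) * (z - d)" using d(2) by (simp add: algebra_simps power2_eq_square)
  hence "a\<^sup>2 / (4 * ((z + d) / 2)) = (z - d) / 2"
  proof -
    have "a\<^sup>2 / (4 * ((z + d) / 2)) = ((z + d) * (z - d)) / ((z + d) * 2)"
      unfolding \<open>a\<^sup>2 = _\<close> by (rule arg_cong2[of _ _ _ _ "(/)"]) simp_all
    also have "\<dots> = (z - d) / 2" using a z d(1) by (intro mult_divide_mult_cancel_left) simp
    finally show ?thesis .
  qed
  thus "z = (z + d) / 2 + a\<^sup>2 / (4 * ((z + d) / 2))" by (simp add: field_simps)
qed

lemma joukowski_strict_mono:
  fixes a x y :: real
  assumes a: "0 < a" and x: "a / 2 < x" and y: "a / 2 < y"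
  shows "x + a\<^sup>2 / (4 * x) < y + a\<^sup>2 / (4 * y) \<longleftrightarrow> x < y"
proof -
  have le: "u + a\<^sup>2 / (4 * u) < v + a\<^sup>2 / (4 * v)" if "a / 2 < u" "u < v" for u v
  proof -
    have "a\<^sup>2 < 4 * (u * v)"
      using mult_strict_mono[of "a / 2" u "a / 2" v] that a by (simp add: power2_eq_square)
    hence "0 < (v - u) * (1 - a\<^sup>2 / (4 * (u * v)))"
      using that a by (intro mult_pos_pos) (auto simp: field_simps)
    also have "\<dots> = (v + a\<^sup>2 / (4 * v)) - (u + a\<^sup>2 / (4 * u))"
      using that a by (simp add: field_simps)
    finally show ?thesis by simp
  qed
  show ?thesis using le[OF x, of y] le[OF y, of x] by (cases x y rule: linorder_cases) auto
qed

lemma stieltjes_semicircle: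
  assumes "0 < a" "a < \<bar>z\<bar>"
  shows "stieltjes (semicircle_law a) z = sc_mean a (\<lambda>x. 1 / (z - x))"
  unfolding stieltjes_def
  by (rule integral_semicircle_law) (use assms in \<open>auto intro!: continuous_intros\<close>)

text \<open>
  The density is even. This reduces the negative critical roots to the positive ones.
\<close>
lemma stieltjes_semicircle_uminus:
  assumes "0 < a" "a < \<bar>z\<bar>"
  shows "stieltjes (semicircle_law a) (- z) = - stieltjes (semicircle_law a) z"
proof -
  have "sc_mean a (\<lambda>x. 1 / (- z - x)) = integral {-a..a} (\<lambda>x. sc_density a (- x) * (1 / (- z - - x)))"
    unfolding sc_mean_def
    using Henstock_Kurzweil_Integration.integral_reflect_real[of a "-a" "\<lambda>x. sc_density a x * (1 / (- z - x))"]
    by simp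
  also have "\<dots> = sc_mean a (\<lambda>x. (- 1) * (1 / (z - x)))"
    unfolding sc_mean_def
  proof (rule integral_cong)
    fix x
    have "1 / (- z - - x) = - (1 / (z - x))"
      unfolding minus_divide_right by (rule arg_cong[of _ _ "(/) 1"]) simp
    thus "sc_density a (- x) * (1 / (- z - - x)) = sc_density a x * (- 1 * (1 / (z - x)))"
      by (simp only: sc_density_def power2_minus mult_minus1)
  qed
  also have "\<dots> = - sc_mean a (\<lambda>x. 1 / (z - x))" by (simp only: sc_mean_cmult)
  finally show ?thesis using assms by (simp add: stieltjes_semicircle)
qed

text \<open>
  With \<open>z/2 = v + a\<^sup>2/(4v)\<close> the equation \<open>z = (1/\<beta>) S(z/2)\<close> reads \<open>2v + a\<^sup>2/(2v) = 1/(\<beta> v)\<close>, that is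
  \<open>v\<^sup>2 = y\<^sup>2\<close>. The bound \<open>\<beta> < 1/a\<^sup>2\<close> is exactly what makes \<open>y > a/2\<close>, so that \<open>v = y\<close> is admissible.
\<close>
lemma critical_roots_eq:
  fixes a \<beta> :: real
  assumes a: "0 < a" and \<beta>: "0 < \<beta>" "\<beta> < 1 / a\<^sup>2"
  defines "y \<equiv> sqrt ((1 / \<beta> - a\<^sup>2 / 2) / 2)"
  shows "a / 2 < y" "y\<^sup>2 = (1 / \<beta> - a\<^sup>2 / 2) / 2"
    "critical_roots a \<beta> = {2 * (y + a\<^sup>2 / (4 * y)), - (2 * (y + a\<^sup>2 / (4 * y)))}"
proof -
  have "a\<^sup>2 < 1 / \<beta>" using a \<beta> by (simp add: field_simps)
  hence "(a / 2)\<^sup>2 < (1 / \<beta> - a\<^sup>2 / 2) / 2" by (simp add: power_divide)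
  hence "sqrt ((a / 2)\<^sup>2) < y" unfolding y_def by (rule real_sqrt_less_mono)
  thus y: "a / 2 < y" using a by simp
  show y2: "y\<^sup>2 = (1 / \<beta> - a\<^sup>2 / 2) / 2"
    unfolding y_def using \<open>(a / 2)\<^sup>2 < _\<close> zero_le_power2[of "a / 2"] by (intro real_sqrt_pow2) linarith
  have pos: "2 * w = 1 / \<beta> * stieltjes (semicircle_law a) w \<longleftrightarrow> w = y + a\<^sup>2 / (4 * y)"
    if w: "a < w" for w
  proof -
    obtain v where v: "a / 2 < v" "w = v + a\<^sup>2 / (4 * v)" using joukowski_surj[OF a w] .
    have v0: "v > 0" using v a by simp
    have "2 * w = 1 / \<beta> * stieltjes (semicircle_law a) w \<longleftrightarrow> 2 * (v + a\<^sup>2 / (4 * v)) = 1 / \<beta> * (1 / v)"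
      using w a sc_mean_resolvent[OF a v] by (simp add: stieltjes_semicircle v(2))
    also have "\<dots> \<longleftrightarrow> v * (2 * (v + a\<^sup>2 / (4 * v))) = v * (1 / \<beta> * (1 / v))"
      using v0 by (simp only: mult_cancel_left) simp
    also have "v * (2 * (v + a\<^sup>2 / (4 * v))) = 2 * v\<^sup>2 + a\<^sup>2 / 2"
      using v0 by (simp add: field_simps power2_eq_square)
    also have "v * (1 / \<beta> * (1 / v)) = 1 / \<beta>" using v0 by simp
    also have "2 * v\<^sup>2 + a\<^sup>2 / 2 = 1 / \<beta> \<longleftrightarrow> v\<^sup>2 = y\<^sup>2" unfolding y2 by (auto simp: field_simps)
    also have "\<dots> \<longleftrightarrow> v = y" using v0 y a by (intro power2_eq_iff_nonneg) auto
    also have "\<dots> \<longleftrightarrow> w = y + a\<^sup>2 / (4 * y)"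
      using joukowski_strict_mono[OF a v(1) y] joukowski_strict_mono[OF a y v(1)] v(2) by force
    finally show ?thesis .
  qed
  define s where "s = y + a\<^sup>2 / (4 * y)"
  have s: "a < s" using joukowski_gt[OF a y] by (simp add: s_def)
  have "z \<in> critical_roots a \<beta> \<longleftrightarrow> z = 2 * s \<or> z = - (2 * s)" for z
  proof (cases "z / 2 > a \<or> z / 2 < - a")
    case False
    thus ?thesis using s a by (auto simp: critical_roots_def)
  next
    case True
    thus ?thesis
    proof
      assume z: "a < z / 2"
      have "z \<in> critical_roots a \<beta> \<longleftrightarrow> z / 2 = s"
        using pos[OF z] z a by (auto simp: critical_roots_def s_def)
      thus ?thesis using z s a by auto
    next
      assume z: "z / 2 < - a"
      hence z': "a < - (z / 2)" by simp
      have "z \<in> critical_roots a \<beta> \<longleftrightarrow> - (z / 2) = s"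
        using pos[OF z'] stieltjes_semicircle_uminus[OF a, of "z / 2"] z a
        by (auto simp: critical_roots_def s_def)
      thus ?thesis using z s a by auto
    qed
  qed
  thus "critical_roots a \<beta> = {2 * (y + a\<^sup>2 / (4 * y)), - (2 * (y + a\<^sup>2 / (4 * y)))}"
    unfolding s_def by blast
qed

lemma card_critical_roots:
  assumes "0 < a" "0 < \<beta>" "\<beta> < 1 / a\<^sup>2"
  shows "card (critical_roots a \<beta>) = 2"
proof -
  define y where "y = sqrt ((1 / \<beta> - a\<^sup>2 / 2) / 2)"
  have "a / 2 < y" unfolding y_def by (rule critical_roots_eq(1)[OF assms])
  hence "0 < y + a\<^sup>2 / (4 * y)" using assms(1) by (intro add_pos_pos divide_pos_pos) auto
  thus ?thesis unfolding critical_roots_eq(3)[OF assms] y_def[symmetric] by simp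
qed

text \<open>
  Both inequalities compare \<open>lam\<^sup>2\<close> with \<open>y\<^sup>2 = (1/\<beta> - a\<^sup>2/2)/2\<close>, since \<open>2 lam b = 2 lam\<^sup>2 + a\<^sup>2/2\<close>. For
  \<open>\<beta> \<ge> 1/a\<^sup>2\<close> the number \<open>y\<^sup>2\<close> is at most \<open>a\<^sup>2/4\<close>, hence below \<open>lam\<^sup>2\<close>, in accordance with
  \<open>s_crit = 2 a < 2 b\<close>.
\<close>
lemma s_crit_compare:
  fixes a \<beta> lam b :: real
  assumes a: "0 < a" and \<beta>: "0 < \<beta>" and lam: "a / 2 < lam" and b: "b = lam + a\<^sup>2 / (4 * lam)"
  shows "2 * b < s_crit a \<beta> \<longleftrightarrow> 1 < 1 / \<beta> / (2 * lam * b)"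
    and "s_crit a \<beta> < 2 * b \<longleftrightarrow> 1 / \<beta> / (2 * lam * b) < 1"
proof -
  have lam0: "0 < lam" using a lam by simp
  have l2: "a\<^sup>2 / 4 < lam\<^sup>2"
    using a lam power_strict_mono[of "a / 2" lam 2] by (auto simp: power_divide)
  have lb: "2 * lam * b = 2 * lam\<^sup>2 + a\<^sup>2 / 2"
    using lam0 by (simp add: b field_simps power2_eq_square)
  have lb0: "0 < 2 * lam * b" unfolding lb using a lam0 by (intro add_pos_pos) auto
  have m: "1 < 1 / \<beta> / (2 * lam * b) \<longleftrightarrow> lam\<^sup>2 < (1 / \<beta> - a\<^sup>2 / 2) / 2"
      "1 / \<beta> / (2 * lam * b) < 1 \<longleftrightarrow> (1 / \<beta> - a\<^sup>2 / 2) / 2 < lam\<^sup>2"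
    unfolding less_divide_eq_1_pos[OF lb0] divide_less_eq_1_pos[OF lb0] by (auto simp: lb)
  have "(2 * b < s_crit a \<beta> \<longleftrightarrow> 1 < 1 / \<beta> / (2 * lam * b)) \<and>
      (s_crit a \<beta> < 2 * b \<longleftrightarrow> 1 / \<beta> / (2 * lam * b) < 1)"
  proof (cases "\<beta> < 1 / a\<^sup>2")
    case True
    define y where "y = sqrt ((1 / \<beta> - a\<^sup>2 / 2) / 2)"
    have y: "a / 2 < y" unfolding y_def by (rule critical_roots_eq(1)[OF a \<beta> True])
    have y2: "y\<^sup>2 = (1 / \<beta> - a\<^sup>2 / 2) / 2"
      unfolding y_def by (rule critical_roots_eq(2)[OF a \<beta> True])
    have "0 < y + a\<^sup>2 / (4 * y)" using y a by (intro add_pos_pos divide_pos_pos) auto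
    hence "s_crit a \<beta> = 2 * (y + a\<^sup>2 / (4 * y))"
      using True unfolding s_crit_def critical_roots_eq(3)[OF a \<beta> True] y_def[symmetric] by simp
    moreover have "lam < y \<longleftrightarrow> lam\<^sup>2 < y\<^sup>2" "y < lam \<longleftrightarrow> y\<^sup>2 < lam\<^sup>2"
      using lam0 y a by (auto simp: power_mono_iff abs_square_less_1 intro!: power_strict_mono dest: power_less_imp_less_base)
    moreover have "2 * p < 2 * q \<longleftrightarrow> p < q" for p q :: real by simp
    ultimately show ?thesis
      using joukowski_strict_mono[OF a lam y, folded b] joukowski_strict_mono[OF a y lam, folded b]
      by (simp only: m y2)
  next
    case False
    hence "1 / \<beta> \<le> a\<^sup>2" using a \<beta> by (simp add: field_simps)
    hence "(1 / \<beta> - a\<^sup>2 / 2) / 2 < lam\<^sup>2" using l2 by simp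
    moreover have "s_crit a \<beta> < 2 * b" using False joukowski_gt[OF a lam] by (simp add: s_crit_def b)
    ultimately show ?thesis using m by auto
  qed
  thus "2 * b < s_crit a \<beta> \<longleftrightarrow> 1 < 1 / \<beta> / (2 * lam * b)"
    and "s_crit a \<beta> < 2 * b \<longleftrightarrow> 1 / \<beta> / (2 * lam * b) < 1" by auto
qed

section \<open>Volterra equations with nonnegative kernel\<close>

text \<open>
  Choose \<open>T\<close> such that the kernel has mass above \<open>1\<close> on \<open>[0, T]\<close>. A lower bound \<open>L\<close> for \<open>x\<close> on a half-line
  then improves to \<open>L + f/2\<close> on the half-line that starts \<open>T\<close> later, so that iterating drives \<open>x\<close> to infinity.
\<close>
lemma volterra_supercritical:
  fixes x F N :: "real \<Rightarrow> real"
  assumes N: "continuous_on {0..} N" "\<And>t. 0 \<le> t \<Longrightarrow> 0 \<le> N t"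
    and x: "continuous_on {0..} x" "\<And>t. 0 \<le> t \<Longrightarrow> 0 \<le> x t"
    and eq: "\<And>t. 0 \<le> t \<Longrightarrow> x t = F t + integral {0..t} (\<lambda>s. N s * x (t - s))"
    and F: "(F \<longlongrightarrow> f) at_top" "0 < f"
    and mass: "((\<lambda>T. integral {0..T} N) \<longlongrightarrow> \<theta>) at_top" "1 < \<theta>"
  shows "filterlim x at_top at_top"
proof -
  have "eventually (\<lambda>T. 1 < integral {0..T} N) at_top"
    using mass by (rule order_tendstoD)
  then obtain T where T: "T \<ge> 1" "1 < integral {0..T} N"
    using eventually_conj[OF _ eventually_ge_at_top[of "1::real"], of "\<lambda>T. 1 < integral {0..T} N"]
    by (auto dest!: eventually_happens)
  have "eventually (\<lambda>t. f / 2 < F t) at_top"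
    using F by (intro order_tendstoD(1)) auto
  then obtain T0 where T0: "\<And>t. t \<ge> T0 \<Longrightarrow> f / 2 < F t" by (auto simp: eventually_at_top_linorder)
  define T1 where "T1 = max T0 0"
  have cint: "continuous_on {0..t} (\<lambda>s. N s * x (t - s))" if "t \<ge> 0" for t
    by (intro continuous_intros continuous_on_subset[OF N(1)] continuous_on_compose2[OF x(1)]) auto
  have grow: "real n * (f / 2) \<le> x t" if "t \<ge> T1 + real n * T" for n t
    using that
  proof (induction n arbitrary: t)
    case 0
    thus ?case using x(2)[of t] by (simp add: T1_def)
  next
    case (Suc n)
    have nT: "0 \<le> real n * T" using T by simp
    have t: "T1 + real n * T + T \<le> t" using Suc.prems by (simp add: algebra_simps)
    moreover have "0 \<le> T1" "T0 \<le> T1" by (auto simp: T1_def)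
    ultimately have t': "0 \<le> t" "T \<le> t" "T0 \<le> t" using nT T(1) by linarith+
    have "real n * (f / 2) \<le> real n * (f / 2) * integral {0..T} N"
      using mult_left_mono[of 1 "integral {0..T} N" "real n * (f / 2)"] T(2) F(2) by simp
    also have "\<dots> = integral {0..T} (\<lambda>s. N s * (real n * (f / 2)))"
      by simp
    also have "\<dots> \<le> integral {0..T} (\<lambda>s. N s * x (t - s))"
    proof (intro integral_le integrable_continuous_real)
      have "continuous_on {0..T} N" by (rule continuous_on_subset[OF N(1)]) auto
      thus "continuous_on {0..T} (\<lambda>s. N s * (real n * (f / 2)))"
        by (intro continuous_on_mult continuous_on_const)
      show "continuous_on {0..T} (\<lambda>s. N s * x (t - s))"
        using t' by (intro continuous_on_subset[OF cint[OF t'(1)]]) auto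
      fix s assume s: "s \<in> {0..T}"
      show "N s * (real n * (f / 2)) \<le> N s * x (t - s)"
        using s t by (intro mult_left_mono Suc.IH N) auto
    qed
    also have "\<dots> \<le> integral {0..t} (\<lambda>s. N s * x (t - s))"
      using t' T(1) by (intro integral_subset_le integrable_continuous_real ballI mult_nonneg_nonneg
          N x continuous_on_subset[OF cint[OF t'(1)]] cint) auto
    finally have "real n * (f / 2) \<le> integral {0..t} (\<lambda>s. N s * x (t - s))" .
    thus ?case using eq[OF t'(1)] T0[OF t'(3)] by (simp add: algebra_simps)
  qed
  show ?thesis
    unfolding filterlim_at_top
  proof
    fix Z
    obtain n :: nat where n: "Z / (f / 2) < real n" using reals_Archimedean2 by blast
    hence "Z \<le> real n * (f / 2)" using F(2) by (simp add: field_simps)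
    hence "Z \<le> x t" if "T1 + real n * T \<le> t" for t using grow[OF that] by linarith
    thus "eventually (\<lambda>t. Z \<le> x t) at_top"
      by (rule eventually_mono[OF eventually_ge_at_top])
  qed
qed

text \<open>
  A mass below \<open>1\<close> makes \<open>y\<close> bounded: where \<open>\<bar>y\<bar>\<close> attains its maximum over \<open>[0, t]\<close>, that maximum is at
  most the forcing term plus \<open>\<theta>\<close> times itself. Then an eventual bound \<open>u\<close> improves to
  \<open>(1 + \<theta>)/2 * u\<close>, because both the forcing term and the tail of the kernel become negligible.
\<close>
lemma volterra_subcritical_null:
  fixes y F N :: "real \<Rightarrow> real"
  assumes N: "continuous_on {0..} N" "\<And>t. 0 \<le> t \<Longrightarrow> 0 \<le> N t"
    and y: "continuous_on {0..} y"
    and eq: "\<And>t. 0 \<le> t \<Longrightarrow> y t = F t + integral {0..t} (\<lambda>s. N s * y (t - s))"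
    and F: "(F \<longlongrightarrow> 0) at_top"
    and mass: "((\<lambda>T. integral {0..T} N) \<longlongrightarrow> \<theta>) at_top" "\<theta> < 1"
  shows "(y \<longlongrightarrow> 0) at_top"
proof -
  have contN: "continuous_on {u..t} N" if "0 \<le> u" for u t
    by (rule continuous_on_subset[OF N(1)]) (use that in auto)
  have intN: "N integrable_on {u..t}" if "0 \<le> u" for u t
    using contN that by (intro integrable_continuous_real)
  have mono: "integral {0..s} N \<le> integral {0..t} N" if "s \<le> t" for s t
    using that N(2) by (intro integral_subset_le intN) auto
  have le: "integral {0..t} N \<le> \<theta>" for t
    by (intro tendsto_lowerbound[OF mass(1)] eventually_mono[OF eventually_ge_at_top[of t]] mono) auto
  have \<theta>0: "0 \<le> \<theta>" using le[of 0] by simp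
  have cy: "continuous_on {u..v} (\<lambda>s. \<bar>y (t - s)\<bar>)" if "v \<le> t" for u v t
    using that by (intro continuous_intros continuous_on_compose2[OF y]) auto
  have tri: "\<bar>y t\<bar> \<le> \<bar>F t\<bar> + integral {0..t} (\<lambda>s. N s * \<bar>y (t - s)\<bar>)" if "0 \<le> t" for t
  proof -
    have c: "continuous_on {0..t} (\<lambda>s. N s * y (t - s))"
      by (intro continuous_intros continuous_on_compose2[OF y] contN) auto
    have c': "continuous_on {0..t} (\<lambda>s. N s * \<bar>y (t - s)\<bar>)"
      by (intro continuous_on_mult contN cy) auto
    have "norm (integral {0..t} (\<lambda>s. N s * y (t - s))) \<le> integral {0..t} (\<lambda>s. N s * \<bar>y (t - s)\<bar>)"
      by (rule integral_norm_bound_integral[OF c[THEN integrable_continuous_real]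
            c'[THEN integrable_continuous_real]]) (use N(2) in \<open>auto simp: abs_mult\<close>)
    thus ?thesis using eq[OF that] by simp
  qed
  have part: "integral {u..v} (\<lambda>s. N s * \<bar>y (t - s)\<bar>) \<le> integral {u..v} N * B"
    if "0 \<le> u" "v \<le> t" "\<And>s. s \<in> {u..v} \<Longrightarrow> \<bar>y (t - s)\<bar> \<le> B" for u v t B
  proof -
    have "integral {u..v} (\<lambda>s. N s * \<bar>y (t - s)\<bar>) \<le> integral {u..v} (\<lambda>s. N s * B)"
      using that N(2)
      by (intro integral_le integrable_continuous_real continuous_on_mult continuous_on_const
          contN cy mult_left_mono) auto
    thus ?thesis by simp
  qed
  obtain T0 where T0: "T0 \<ge> 0" "\<And>t. t \<ge> T0 \<Longrightarrow> \<bar>F t\<bar> \<le> 1"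
  proof -
    have "eventually (\<lambda>t. \<bar>F t\<bar> < 1) at_top"
      using tendsto_rabs[OF F] by (intro order_tendstoD(2)[of _ 0]) auto
    then obtain c where "\<And>t. t \<ge> c \<Longrightarrow> \<bar>F t\<bar> < 1" by (auto simp: eventually_at_top_linorder)
    thus ?thesis by (intro that[of "max c 0"]) (auto intro: less_imp_le)
  qed
  have "compact (y ` {0..T0})"
    by (intro compact_continuous_image continuous_on_subset[OF y]) auto
  then obtain B0 where B0: "\<And>t. t \<in> {0..T0} \<Longrightarrow> \<bar>y t\<bar> \<le> B0"
    by (force dest!: compact_imp_bounded simp: bounded_iff)
  define B where "B = max B0 (1 / (1 - \<theta>))"
  have bound: "\<bar>y t\<bar> \<le> B" if "0 \<le> t" for t
  proof -
    have "\<exists>\<tau>\<in>{0..t}. \<forall>s\<in>{0..t}. \<bar>y s\<bar> \<le> \<bar>y \<tau>\<bar>"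
      using that by (intro continuous_attains_sup continuous_intros continuous_on_subset[OF y]) auto
    then obtain \<tau> where \<tau>: "\<tau> \<in> {0..t}" "\<And>s. s \<in> {0..t} \<Longrightarrow> \<bar>y s\<bar> \<le> \<bar>y \<tau>\<bar>" by auto
    have "\<bar>y \<tau>\<bar> \<le> B"
    proof (cases "\<tau> \<le> T0")
      case True
      thus ?thesis using B0[of \<tau>] \<tau>(1) by (auto simp: B_def)
    next
      case False
      have "integral {0..\<tau>} (\<lambda>s. N s * \<bar>y (\<tau> - s)\<bar>) \<le> integral {0..\<tau>} N * \<bar>y \<tau>\<bar>"
        using \<tau> by (intro part) auto
      also have "\<dots> \<le> \<theta> * \<bar>y \<tau>\<bar>" by (intro mult_right_mono le) auto
      finally have "\<bar>y \<tau>\<bar> \<le> 1 + \<theta> * \<bar>y \<tau>\<bar>"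
        using tri[of \<tau>] T0(2)[of \<tau>] \<tau>(1) False by auto
      hence "\<bar>y \<tau>\<bar> \<le> 1 / (1 - \<theta>)" using mass(2) by (simp add: field_simps)
      thus ?thesis by (simp add: B_def)
    qed
    thus ?thesis using \<tau>(2)[of t] that by auto
  qed
  have B0: "0 < B" using mass(2) by (simp add: B_def less_max_iff_disj)
  have improve: "eventually (\<lambda>t. \<bar>y t\<bar> \<le> (1 + \<theta>) / 2 * u) at_top"
    if u: "0 < u" and ev: "eventually (\<lambda>t. \<bar>y t\<bar> \<le> u) at_top" for u
  proof -
    \<comment> \<open>The loss \<open>2 * \<epsilon>\<close>, half for the forcing term and half for the kernel tail, is what separates \<open>\<theta> * u\<close> from \<open>(1 + \<theta>) / 2 * u\<close>.\<close>
    define \<epsilon> where "\<epsilon> = (1 - \<theta>) / 4 * u"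
    have \<epsilon>: "\<epsilon> > 0" using mass(2) u by (simp add: \<epsilon>_def)
    have "eventually (\<lambda>T. \<theta> - \<epsilon> / B < integral {0..T} N) at_top"
      using mass(1) by (rule order_tendstoD) (use \<epsilon> B0 in auto)
    then obtain T where T: "T \<ge> 0" "\<theta> - \<epsilon> / B < integral {0..T} N"
      using eventually_conj[OF _ eventually_ge_at_top[of "0::real"]]
      by (metis (no_types, lifting) eventually_happens trivial_limit_at_top_linorder)
    obtain T2 where T2: "\<And>t. t \<ge> T2 \<Longrightarrow> \<bar>y t\<bar> \<le> u" using ev by (auto simp: eventually_at_top_linorder)
    have "eventually (\<lambda>t. \<bar>F t\<bar> < \<epsilon>) at_top"
      using tendsto_rabs[OF F] \<epsilon> by (intro order_tendstoD(2)[of _ 0]) auto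
    thus ?thesis using eventually_ge_at_top[of "T + T2"] eventually_ge_at_top[of T]
    proof eventually_elim
      case (elim t)
      have t0: "0 \<le> t" using elim T by simp
      have "integral {0..t} (\<lambda>s. N s * \<bar>y (t - s)\<bar>)
          = integral {0..T} (\<lambda>s. N s * \<bar>y (t - s)\<bar>) + integral {T..t} (\<lambda>s. N s * \<bar>y (t - s)\<bar>)"
        using elim T by (intro Henstock_Kurzweil_Integration.integral_combine[symmetric]
            integrable_continuous_real continuous_on_mult contN cy) auto
      moreover have "integral {0..T} (\<lambda>s. N s * \<bar>y (t - s)\<bar>) \<le> integral {0..T} N * u"
        using elim T by (intro part T2) auto
      moreover have "\<dots> \<le> \<theta> * u" using u by (intro mult_right_mono le) auto
      moreover have "integral {T..t} (\<lambda>s. N s * \<bar>y (t - s)\<bar>) \<le> integral {T..t} N * B"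
        using elim T by (intro part bound) auto
      moreover have "integral {0..T} N + integral {T..t} N = integral {0..t} N"
        using elim T by (intro Henstock_Kurzweil_Integration.integral_combine intN) auto
      hence "integral {T..t} N \<le> \<epsilon> / B" using T(2) le[of t] by linarith
      hence "integral {T..t} N * B \<le> \<epsilon>" using B0 by (simp add: field_simps)
      ultimately have "\<bar>y t\<bar> \<le> 2 * \<epsilon> + \<theta> * u" using tri[OF t0] elim(1) by linarith
      thus ?case by (simp add: \<epsilon>_def field_simps)
    qed
  qed
  have pow: "eventually (\<lambda>t. \<bar>y t\<bar> \<le> ((1 + \<theta>) / 2) ^ n * B) at_top" for n
  proof (induction n)
    case 0
    show ?case using eventually_ge_at_top[of 0] by eventually_elim (use bound in auto)
  next
    case (Suc n)
    show ?case using improve[OF _ Suc] B0 \<theta>0 by (simp add: mult.assoc)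
  qed
  show ?thesis
  proof (rule tendstoI)
    fix e :: real assume e: "e > 0"
    have "(\<lambda>n. ((1 + \<theta>) / 2) ^ n * B) \<longlonglongrightarrow> 0 * B"
      using \<theta>0 mass(2) by (intro tendsto_intros LIMSEQ_realpow_zero) auto
    hence "eventually (\<lambda>n. ((1 + \<theta>) / 2) ^ n * B < e) sequentially"
      using e by (intro order_tendstoD(2)[of _ "0 * B"]) auto
    then obtain n where "((1 + \<theta>) / 2) ^ n * B < e" by (auto dest!: eventually_happens)
    thus "eventually (\<lambda>t. dist (y t) 0 < e) at_top"
      using pow[of n] by (auto elim!: eventually_mono simp: dist_real_def)
  qed
qed

lemma volterra_subcritical:
  fixes x F N :: "real \<Rightarrow> real"
  assumes N: "continuous_on {0..} N" "\<And>t. 0 \<le> t \<Longrightarrow> 0 \<le> N t"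
    and x: "continuous_on {0..} x"
    and eq: "\<And>t. 0 \<le> t \<Longrightarrow> x t = F t + integral {0..t} (\<lambda>s. N s * x (t - s))"
    and F: "(F \<longlongrightarrow> f) at_top"
    and mass: "((\<lambda>T. integral {0..T} N) \<longlongrightarrow> \<theta>) at_top" "\<theta> < 1"
  shows "(x \<longlongrightarrow> f / (1 - \<theta>)) at_top"
proof -
  define L where "L = f / (1 - \<theta>)"
  define F' where "F' t = F t - L + integral {0..t} N * L" for t
  have "((\<lambda>t. x t - L) \<longlongrightarrow> 0) at_top"
  proof (rule volterra_subcritical_null[OF N _ _ _ mass])
    show "continuous_on {0..} (\<lambda>t. x t - L)" by (intro continuous_intros x)
    have "f - L + \<theta> * L = 0" using mass(2) by (simp add: L_def field_simps)
    thus "(F' \<longlongrightarrow> 0) at_top"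
      unfolding F'_def using tendsto_add[OF tendsto_diff[OF F tendsto_const] tendsto_mult[OF mass(1) tendsto_const], of L L]
      by simp
    fix t :: real assume t: "0 \<le> t"
    have "continuous_on {0..t} N" by (rule continuous_on_subset[OF N(1)]) auto
    moreover have "continuous_on {0..t} (\<lambda>s. x (t - s))"
      by (intro continuous_intros continuous_on_compose2[OF x]) auto
    ultimately have "integral {0..t} (\<lambda>s. N s * (x (t - s) - L))
        = integral {0..t} (\<lambda>s. N s * x (t - s)) - integral {0..t} (\<lambda>s. N s * L)"
      unfolding right_diff_distrib
      by (intro Henstock_Kurzweil_Integration.integral_diff integrable_continuous_real continuous_intros)
    thus "x t - L = F' t + integral {0..t} (\<lambda>s. N s * (x (t - s) - L))"
      using eq[OF t] by (simp add: F'_def)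
  qed
  from tendsto_add[OF this tendsto_const[of L]] show ?thesis by (simp add: L_def)
qed

section \<open>Integrals over growing intervals and exponential decay\<close>

lemma DERIV_integral_from_0:
  fixes f :: "real \<Rightarrow> real"
  assumes f: "continuous_on {0..} f" and t: "0 \<le> t"
  shows "((\<lambda>t. integral {0..t} f) has_real_derivative f t) (at t within {0..})"
proof -
  have "((\<lambda>t. integral {0..t} f) has_real_derivative f t) (at t within {0..t + 1})"
    using t by (intro integral_has_real_derivative continuous_on_subset[OF f]) auto
  also have "at t within {0..t + 1} = at t within {0..}"
    by (rule at_within_nhd[of t "{..<t + 1}"]) auto
  finally show ?thesis .
qed

lemma integral_reflect_interval:
  fixes f :: "real \<Rightarrow> real"
  assumes "continuous_on {0..t} f"
  shows "integral {0..t} (\<lambda>s. f (t - s)) = integral {0..t} f"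
proof -
  have c: "continuous_on {- t + t..0 + t} (\<lambda>s. f (t - s))"
    by (intro continuous_on_compose2[OF assms] continuous_intros) auto
  have "integral {0..t} (\<lambda>s. f (t - s)) = integral {- t..0} ((\<lambda>s. f (t - s)) \<circ> (\<lambda>x. x + t))"
    using integral_shift[OF c] by simp
  also have "\<dots> = integral {0..t} f"
    using Henstock_Kurzweil_Integration.integral_reflect_real[of t 0 f] by (simp add: o_def)
  finally show ?thesis .
qed

lemma exp_decay: "0 < c \<Longrightarrow> ((\<lambda>t::real. exp (- (c * t))) \<longlongrightarrow> 0) at_top"
  by (intro filterlim_compose[OF exp_at_bot] filterlim_compose[OF filterlim_uminus_at_bot_at_top]
      filterlim_tendsto_pos_mult_at_top[OF tendsto_const] filterlim_ident)

lemma mult_exp_decay: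
  assumes c: "0 < c"
  shows "((\<lambda>t::real. t * exp (- (c * t))) \<longlongrightarrow> 0) at_top"
proof -
  have "((\<lambda>t. 1 / c * ((c * t) ^ 1 / exp (c * t))) \<longlongrightarrow> 1 / c * 0) at_top"
    by (intro tendsto_mult tendsto_const filterlim_compose[OF tendsto_power_div_exp_0]
        filterlim_tendsto_pos_mult_at_top[OF tendsto_const c] filterlim_ident)
  thus ?thesis using c by (simp add: exp_minus field_simps)
qed

section \<open>The overlap as the flow of a rank-one perturbation\<close>

text \<open>
  In terms of the operator \<open>J g = x g + y (E g)\<close>, whose top eigenfunction is \<open>\<psi> = 1/(z - x)\<close>, on functions
  orthogonal to \<open>\<psi>\<close> the rank-one part is at most a proper fraction of the form \<open>E ((z - x) g\<^sup>2)\<close>.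
  Cauchy-Schwarz for \<open>E (g \<cdot> 1)\<close> with the weight \<open>z - x\<close> gives the fraction \<open>1\<close>, because \<open>y E \<psi> = 1\<close>.
  Orthogonality allows replacing the constant \<open>1\<close> by \<open>1 - (z - a) \<psi> = (a - x)/(z - x)\<close>, which lies between \<open>0\<close> and \<open>2a/(a + z) < 1\<close> on \<open>[-a, a]\<close>.
\<close>
lemma spectral_gap:
  fixes a y z :: real
  assumes a: "0 < a" and y: "a / 2 < y" and z: "z = y + a\<^sup>2 / (4 * y)"
    and g: "continuous_on {-a..a} g" and orth: "sc_mean a (\<lambda>x. g x / (z - x)) = 0"
  shows "y * (sc_mean a g)\<^sup>2 \<le> (2 * a / (a + z))\<^sup>2 * sc_mean a (\<lambda>x. (z - x) * (g x)\<^sup>2)"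
proof -
  have y0: "y > 0" using a y by simp
  have za: "z > a" using joukowski_gt[OF a y] z by simp
  have zx: "z - x > 0" if "x \<in> {-a..a}" for x using za that by auto
  define \<eta> where "\<eta> = 2 * a / (a + z)"
  have \<eta>: "\<eta> > 0" using a za by (simp add: \<eta>_def)
  define m where "m = sc_mean a g"
  define P where "P = sc_mean a (\<lambda>x. (z - x) * (g x)\<^sup>2)"
  \<comment> \<open>The minimiser in \<open>B\<close> of the quadratic bound below; completing the square with it proves Cauchy-Schwarz.\<close>
  define B where "B = y * m / \<eta>\<^sup>2"
  define W where "W = sc_mean a (\<lambda>x. (a - x)\<^sup>2 / (z - x) ^ 3)"
  have c1: "continuous_on {-a..a} (\<lambda>x. g x / (z - x))"
    using zx by (intro continuous_intros g) force
  have c2: "continuous_on {-a..a} (\<lambda>x. (a - x)\<^sup>2 / (z - x) ^ 3)"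
    using zx by (intro continuous_intros) force
  have c3: "continuous_on {-a..a} (\<lambda>x. (z - x) * (g x)\<^sup>2)" by (intro continuous_intros g)
  have c4: "continuous_on {-a..a} (\<lambda>x. \<eta>\<^sup>2 * (1 / (z - x)))" using zx by (intro continuous_intros) force
  have c5: "continuous_on {-a..a} (\<lambda>x. g x - (z - a) * (g x / (z - x)))"
    by (intro continuous_on_diff continuous_on_mult continuous_on_const c1 g)
  have m: "sc_mean a (\<lambda>x. g x - (z - a) * (g x / (z - x))) = m"
    using sc_mean_diff[OF g continuous_on_mult[OF continuous_on_const c1], of "z - a"]
    unfolding sc_mean_cmult orth by (simp add: m_def)
  have "0 \<le> sc_mean a (\<lambda>x. 1 * ((z - x) * (g x)\<^sup>2) + (- 2 * B) * (g x - (z - a) * (g x / (z - x)))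
      + B\<^sup>2 * ((a - x)\<^sup>2 / (z - x) ^ 3))"
  proof (rule sc_mean_nonneg)
    show "continuous_on {- a..a} (\<lambda>x. 1 * ((z - x) * (g x)\<^sup>2) + (- 2 * B) * (g x - (z - a) * (g x / (z - x)))
        + B\<^sup>2 * ((a - x)\<^sup>2 / (z - x) ^ 3))"
      by (intro continuous_on_add continuous_on_mult continuous_on_const c2 c3 c5)
    fix x assume x: "x \<in> {-a..a}"
    note zx = zx[OF x]
    define q where "q = (a - x) / (z - x)\<^sup>2"
    have "(z - x) * (g x - B * q)\<^sup>2 = (z - x) * (g x)\<^sup>2 - 2 * B * (g x * ((z - x) * q)) + B\<^sup>2 * ((z - x) * q\<^sup>2)"
      by algebra
    also have "(z - x) * q = (a - x) / (z - x)" using zx by (simp add: q_def power2_eq_square)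
    also have "(z - x) * q\<^sup>2 = (a - x)\<^sup>2 / (z - x) ^ 3"
      using zx by (simp add: q_def power_divide eval_nat_numeral)
    also have "g x * ((a - x) / (z - x)) = g x - (z - a) * (g x / (z - x))"
      using zx by (simp add: field_simps)
    finally show "0 \<le> 1 * ((z - x) * (g x)\<^sup>2) + (- 2 * B) * (g x - (z - a) * (g x / (z - x)))
        + B\<^sup>2 * ((a - x)\<^sup>2 / (z - x) ^ 3)"
      using zx mult_nonneg_nonneg[OF less_imp_le[OF zx] zero_le_power2, of "g x - B * q"] by simp
  qed
  also have "\<dots> = P - 2 * B * m + B\<^sup>2 * W"
    unfolding sc_mean_lincomb[OF c3 c5 c2] m by (simp add: P_def W_def)
  also have "W \<le> sc_mean a (\<lambda>x. \<eta>\<^sup>2 * (1 / (z - x)))"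
    unfolding W_def
  proof (rule sc_mean_mono[OF c2 c4])
    fix x assume x: "x \<in> {-a..a}"
    note zx = zx[OF x]
    have "(a - x) * (a + z) \<le> 2 * a * (z - x)"
      using mult_nonneg_nonneg[of "z - a" "x + a"] za x by (simp add: algebra_simps)
    hence "(a - x) / (z - x) \<le> \<eta>" using zx a za by (simp add: \<eta>_def field_simps)
    hence "((a - x) / (z - x))\<^sup>2 \<le> \<eta>\<^sup>2" using x zx by (intro power_mono) auto
    hence "((a - x) / (z - x))\<^sup>2 * (1 / (z - x)) \<le> \<eta>\<^sup>2 * (1 / (z - x))"
      using zx by (intro mult_right_mono) auto
    thus "(a - x)\<^sup>2 / (z - x) ^ 3 \<le> \<eta>\<^sup>2 * (1 / (z - x))"
      by (simp add: power_divide eval_nat_numeral mult.assoc)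
  qed
  also have "sc_mean a (\<lambda>x. \<eta>\<^sup>2 * (1 / (z - x))) = \<eta>\<^sup>2 / y"
    by (simp only: sc_mean_cmult sc_mean_resolvent[OF a y z]) simp
  finally have "0 \<le> P - 2 * B * m + B\<^sup>2 * (\<eta>\<^sup>2 / y)"
    by (simp add: mult_left_mono)
  also have "\<dots> = P - y * m\<^sup>2 / \<eta>\<^sup>2"
    using \<eta> y0 by (simp add: B_def field_simps power2_eq_square)
  finally have "y * m\<^sup>2 \<le> P * \<eta>\<^sup>2" using \<eta> by (simp add: field_simps)
  thus ?thesis by (simp add: m_def P_def \<eta>_def mult.commute)
qed

text \<open>
  The scaled overlap \<open>r = R/h\<close>, with \<open>\<kappa>\<close> the correlation of the initial state with the spike.
\<close>
locale spiked_modes =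
  fixes a lam b \<kappa> :: real and r :: "real \<Rightarrow> real"
  assumes a_pos: "0 < a" and lam_gt: "a / 2 < lam" and b_eq: "b = lam + a\<^sup>2 / (4 * lam)"
    and cont_r: "continuous_on {0..} r"
    and r_eq: "\<And>t. 0 \<le> t \<Longrightarrow> r t = \<kappa> * sc_mean a (\<lambda>x. exp (x * t))
        + lam * integral {0..t} (\<lambda>s. r s * sc_mean a (\<lambda>x. exp (x * (t - s))))"
begin

lemma lam_pos: "0 < lam" using a_pos lam_gt by simp

lemma b_gt: "a < b" using joukowski_gt[OF a_pos lam_gt] b_eq by simp

lemma lam_sq_gt: "a\<^sup>2 / 4 < lam\<^sup>2"
  using a_pos lam_gt power_strict_mono[of "a / 2" lam 2] by (auto simp: power_divide)

text \<open>
  The function \<open>exp(b t) * mode t x\<close> is the flow of \<open>J\<close> at time \<open>t\<close> and point \<open>x\<close>, started at the constant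
  \<open>\<kappa>\<close>. Duhamel's formula expresses it through \<open>memory\<close>. Below, \<open>top_coeff\<close> is the coefficient of the
  eigenfunction \<open>1/(b - x)\<close> in the orthogonal projection of \<open>\<kappa>\<close>, namely
  \<open>\<kappa> E (1/(b - x)) / E (1/(b - x)\<^sup>2)\<close>, and \<open>rest\<close> is the component of \<open>mode\<close> orthogonal to it.
\<close>
definition memory :: "real \<Rightarrow> real \<Rightarrow> real" where
  "memory t x = integral {0..t} (\<lambda>s. exp (- (x * s)) * r s)"

definition mode :: "real \<Rightarrow> real \<Rightarrow> real" where
  "mode t x = exp (- ((b - x) * t)) * (\<kappa> + lam * memory t x)"

definition top_coeff :: real where
  "top_coeff = \<kappa> * (lam\<^sup>2 - a\<^sup>2 / 4) / lam"

definition rest :: "real \<Rightarrow> real \<Rightarrow> real" where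
  "rest t x = mode t x - top_coeff * (1 / (b - x))"

definition energy :: "real \<Rightarrow> real" where
  "energy t = sc_mean a (\<lambda>x. (rest t x)\<^sup>2)"

lemma cont_r_subset: "S \<subseteq> {0..} \<Longrightarrow> continuous_on S r"
  using continuous_on_subset[OF cont_r] .

text \<open>
  A fixed domain of integration, so that continuity in \<open>(t, x)\<close> jointly is a statement about parameters only.
\<close>
lemma memory_scaled:
  assumes "0 \<le> t"
  shows "memory t x = integral {0..1} (\<lambda>u. t * (exp (- (x * (t * u))) * r (t * u)))"
proof -
  have "((\<lambda>u. t *\<^sub>R (exp (- (x * (t * u))) * r (t * u))) has_integral
      integral {t * 0..t * 1} (\<lambda>s. exp (- (x * s)) * r s)) {0..1}"
    using assms
    by (intro has_integral_substitution[where c = 0 and d = t] continuous_intros cont_r_subset)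
       (auto intro!: derivative_eq_intros mult_left_le)
  from integral_unique[OF this] show ?thesis
    by (simp only: memory_def mult_zero_right mult_1_right real_scaleR_def)
qed

lemma continuous_memory: "continuous_on ({0..} \<times> UNIV) (\<lambda>(t, x). memory t x)"
proof -
  have "continuous_on ({0..} \<times> UNIV) (\<lambda>p. integral (cbox 0 1)
      (\<lambda>u. fst p * (exp (- (snd p * (fst p * u))) * r (fst p * u))))"
    by (rule integral_continuous_on_param, unfold case_prod_unfold)
      (intro continuous_intros continuous_on_compose2[OF cont_r], auto)
  thus ?thesis
    by (rule continuous_on_cong[THEN iffD1, rotated -1]) (auto simp: memory_scaled)
qed

lemma continuous_mode: "continuous_on ({0..} \<times> UNIV) (\<lambda>(t, x). mode t x)"
  using continuous_memory unfolding mode_def case_prod_unfold by (intro continuous_intros)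

lemma continuous_rest: "continuous_on ({0..} \<times> {-a..a}) (\<lambda>(t, x). rest t x)"
  unfolding rest_def case_prod_unfold
  using b_gt by (intro continuous_intros continuous_on_compose2[OF continuous_mode[unfolded case_prod_unfold], simplified]) auto

lemma continuous_slices:
  assumes "0 \<le> t"
  shows "continuous_on S (memory t)" "continuous_on S (mode t)" "continuous_on {-a..a} (rest t)"
proof -
  have p: "continuous_on S (\<lambda>x. (t, x))" for S :: "real set" by (intro continuous_intros)
  show "continuous_on S (memory t)" "continuous_on S (mode t)" "continuous_on {-a..a} (rest t)"
    using assms continuous_on_compose2[OF continuous_memory p] continuous_on_compose2[OF continuous_mode p]
      continuous_on_compose2[OF continuous_rest p] by auto
qed

text \<open>
  Averaging the past of \<open>r\<close> against exponentials factorises at each \<open>x\<close>. Every integral against \<open>r\<close> in the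
  two equations has this shape; the double integral arises by taking \<open>g\<close> to be \<open>memory t\<close> itself.
\<close>
lemma response_mean:
  assumes "0 \<le> t" "continuous_on {-a..a} g"
  shows "integral {0..t} (\<lambda>s. r s * sc_mean a (\<lambda>x. exp (x * (w - s)) * g x)) =
    sc_mean a (\<lambda>x. exp (x * w) * g x * memory t x)"
proof -
  have "integral {0..t} (\<lambda>s. sc_mean a (\<lambda>x. r s * (exp (x * (w - s)) * g x)))
      = sc_mean a (\<lambda>x. integral {0..t} (\<lambda>s. r s * (exp (x * (w - s)) * g x)))"
    unfolding case_prod_unfold
    by (intro sc_mean_swap, unfold case_prod_unfold)
       (intro continuous_intros continuous_on_compose2[OF cont_r] continuous_on_compose2[OF assms(2)], auto)
  also have "\<dots> = sc_mean a (\<lambda>x. exp (x * w) * g x * memory t x)"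
    by (intro sc_mean_cong)
      (simp add: memory_def exp_diff exp_minus field_simps flip: integral_mult_right)
  finally show ?thesis by (simp add: sc_mean_cmult)
qed

lemma mean_mode: "0 \<le> t \<Longrightarrow> sc_mean a (mode t) = exp (- (b * t)) * r t"
proof -
  assume t: "0 \<le> t"
  have "sc_mean a (mode t) = sc_mean a (\<lambda>x. exp (- (b * t)) * (\<kappa> * exp (x * t) + lam * (exp (x * t) * memory t x)))"
  proof (rule sc_mean_cong)
    fix x
    have "exp (- ((b - x) * t)) = exp (- (b * t)) * exp (x * t)"
      by (simp add: exp_add[symmetric] algebra_simps)
    thus "mode t x = exp (- (b * t)) * (\<kappa> * exp (x * t) + lam * (exp (x * t) * memory t x))"
      by (simp add: mode_def algebra_simps)
  qed
  also have "\<dots> = exp (- (b * t)) * (\<kappa> * sc_mean a (\<lambda>x. exp (x * t)) + lam * sc_mean a (\<lambda>x. exp (x * t) * memory t x))"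
  proof -
    have c: "continuous_on {-a..a} (\<lambda>x. exp (x * t))"
        "continuous_on {-a..a} (\<lambda>x. exp (x * t) * memory t x)"
      using t by (auto intro!: continuous_intros continuous_slices)
    show ?thesis
      unfolding sc_mean_cmult using sc_mean_lincomb[OF c c(2), of \<kappa> lam 0] by simp
  qed
  also have "\<dots> = exp (- (b * t)) * r t"
    unfolding r_eq[OF t] using response_mean[OF t, of "\<lambda>_. 1" t] by simp
  finally show ?thesis .
qed

lemma memory_deriv:
  "0 \<le> t \<Longrightarrow> ((\<lambda>t. memory t x) has_real_derivative exp (- (x * t)) * r t) (at t within {0..})"
  unfolding memory_def by (intro DERIV_integral_from_0 continuous_intros cont_r)

lemma mode_deriv:
  assumes t: "0 \<le> t"
  shows "((\<lambda>t. mode t x) has_real_derivative - ((b - x) * mode t x) + lam * (exp (- (b * t)) * r t))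
    (at t within {0..})"
  unfolding mode_def
  by (rule derivative_eq_intros memory_deriv[OF t] refl | simp)+
     (simp add: algebra_simps exp_diff exp_add exp_minus divide_simps)

lemma mean_top: "sc_mean a (\<lambda>x. 1 / (b - x)) = 1 / lam"
  by (rule sc_mean_resolvent[OF a_pos lam_gt b_eq])

lemma mean_top_sq: "sc_mean a (\<lambda>x. 1 / (b - x)\<^sup>2) = 1 / (lam\<^sup>2 - a\<^sup>2 / 4)"
  by (rule sc_mean_resolvent_sq[OF a_pos lam_gt b_eq])

lemma continuous_top: "continuous_on {-a..a} (\<lambda>x. 1 / (b - x))"
  using b_gt by (intro continuous_intros) auto

text \<open>
  The inner product of \<open>mode\<close> with the eigenfunction \<open>1/(b - x)\<close> is conserved: the two contributions to
  its derivative cancel because \<open>lam E (1/(b - x)) = 1\<close>. At time \<open>0\<close> it equals \<open>\<kappa>/lam\<close>, the value that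
  \<open>top_coeff\<close> was chosen to match.
\<close>
lemma rest_orthogonal:
  assumes t: "0 \<le> t"
  shows "sc_mean a (\<lambda>x. rest t x / (b - x)) = 0"
proof -
  have "((\<lambda>t. sc_mean a (\<lambda>x. mode t x * (1 / (b - x)))) has_real_derivative 0) (at s within {0..})"
    if s: "s \<in> {0..}" for s
  proof -
    have "((\<lambda>t. sc_mean a (\<lambda>x. mode t x * (1 / (b - x)))) has_real_derivative
        sc_mean a (\<lambda>x. lam * (exp (- (b * s)) * r s) * (1 / (b - x)) - mode s x)) (at s within {0..})"
    proof (rule has_derivative_sc_mean[where U = "{0..}"])
      fix t x :: real assume "t \<in> {0..}" "x \<in> {-a..a}"
      hence "t \<ge> 0" "b - x > 0" using b_gt by auto
      thus "((\<lambda>t. mode t x * (1 / (b - x))) has_real_derivative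
          lam * (exp (- (b * t)) * r t) * (1 / (b - x)) - mode t x) (at t within {0..})"
        by (intro DERIV_cmult_right[OF mode_deriv, THEN DERIV_cong]) (auto simp: field_simps)
    next
      fix t :: real assume "t \<in> {0..}"
      thus "continuous_on {-a..a} (\<lambda>x. mode t x * (1 / (b - x)))"
        by (intro continuous_on_mult continuous_top continuous_slices) auto
    next
      show "continuous_on ({0..} \<times> {- a..a})
          (\<lambda>(t, x). lam * (exp (- (b * t)) * r t) * (1 / (b - x)) - mode t x)"
        unfolding case_prod_unfold using b_gt
        by (intro continuous_intros continuous_on_compose2[OF cont_r]
            continuous_on_compose2[OF continuous_mode[unfolded case_prod_unfold], simplified]) auto
    qed (use s in auto)
    also have "sc_mean a (\<lambda>x. lam * (exp (- (b * s)) * r s) * (1 / (b - x)) - mode s x) = 0"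
      using sc_mean_lincomb[OF continuous_top continuous_slices(2) continuous_top,
          of s "lam * (exp (- (b * s)) * r s)" "- 1" 0] s lam_pos mean_mode[of s] mean_top
      by simp
    finally show ?thesis .
  qed
  hence "\<exists>c. \<forall>s\<in>{0..}. sc_mean a (\<lambda>x. mode s x * (1 / (b - x))) = c"
    by (intro has_field_derivative_zero_constant) auto
  then obtain c where c: "\<And>s. s \<in> {0..} \<Longrightarrow> sc_mean a (\<lambda>x. mode s x * (1 / (b - x))) = c"
    by blast
  have "sc_mean a (\<lambda>x. mode t x * (1 / (b - x))) = sc_mean a (\<lambda>x. mode 0 x * (1 / (b - x)))"
    using c[of 0] c[of t] t by simp
  also have "\<dots> = \<kappa> / lam"
    using sc_mean_cmult[of a \<kappa> "\<lambda>x. 1 / (b - x)"] by (simp add: mode_def memory_def mean_top)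
  finally have *: "sc_mean a (\<lambda>x. mode t x * (1 / (b - x))) = \<kappa> / lam" .
  have "sc_mean a (\<lambda>x. rest t x / (b - x)) =
      sc_mean a (\<lambda>x. mode t x * (1 / (b - x)) - top_coeff * (1 / (b - x)\<^sup>2))"
    by (intro sc_mean_cong) (simp add: rest_def diff_divide_distrib power2_eq_square)
  also have "\<dots> = \<kappa> / lam - top_coeff * (1 / (lam\<^sup>2 - a\<^sup>2 / 4))"
  proof -
    have c: "continuous_on {-a..a} (\<lambda>x. mode t x * (1 / (b - x)))" "continuous_on {-a..a} (\<lambda>x. 1 / (b - x)\<^sup>2)"
      using b_gt t by (auto intro!: continuous_intros continuous_slices)
    show ?thesis
      using sc_mean_lincomb[OF c c(1), of 1 "- top_coeff" 0] unfolding * mean_top_sq by simp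
  qed
  also have "\<dots> = 0" using lam_sq_gt lam_pos by (simp add: top_coeff_def)
  finally show ?thesis .
qed

lemma mean_rest:
  assumes t: "0 \<le> t"
  shows "sc_mean a (rest t) = exp (- (b * t)) * r t - top_coeff / lam"
  using sc_mean_lincomb[OF continuous_slices(2)[OF t] continuous_top continuous_top, of 1 "- top_coeff" 0]
  unfolding mean_mode[OF t] mean_top by (simp add: rest_def[abs_def])

definition gap_ratio :: real where
  "gap_ratio = (2 * a / (a + b))\<^sup>2"

lemma gap_ratio: "0 \<le> gap_ratio" "gap_ratio < 1"
  using a_pos b_gt by (auto simp: gap_ratio_def intro!: power_less_one_iff[THEN iffD2])

lemma rest_gap:
  "0 \<le> t \<Longrightarrow> lam * (sc_mean a (rest t))\<^sup>2 \<le> gap_ratio * sc_mean a (\<lambda>x. (b - x) * (rest t x)\<^sup>2)"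
  unfolding gap_ratio_def
  by (intro spectral_gap a_pos lam_gt b_eq continuous_slices rest_orthogonal)

text \<open>
  The component \<open>rest\<close> solves the same linear equation as \<open>mode\<close>, since the eigenfunction is stationary for it.
\<close>
lemma energy_deriv:
  assumes t: "0 \<le> t"
  shows "(energy has_real_derivative
    2 * (lam * (sc_mean a (rest t))\<^sup>2 - sc_mean a (\<lambda>x. (b - x) * (rest t x)\<^sup>2))) (at t within {0..})"
proof -
  \<comment> \<open>The inhomogeneity that remains after \<open>(b - x) * mode\<close> is rewritten through \<open>rest\<close>; it is \<open>lam\<close> times the mean of \<open>rest\<close>.\<close>
  define c where "c s = lam * (exp (- (b * s)) * r s) - top_coeff" for s
  have "(energy has_real_derivative
      sc_mean a (\<lambda>x. 2 * (c t * rest t x - (b - x) * (rest t x)\<^sup>2))) (at t within {0..})"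
    unfolding energy_def[abs_def]
  proof (rule has_derivative_sc_mean[where U = "{0..}"])
    fix t x :: real assume "t \<in> {0..}" "x \<in> {-a..a}"
    hence t: "t \<ge> 0" and x: "b - x > 0" using b_gt by auto
    have "((\<lambda>t. rest t x) has_real_derivative c t - (b - x) * rest t x) (at t within {0..})"
      unfolding rest_def
    proof (rule DERIV_diff[OF mode_deriv[OF t] DERIV_const, THEN DERIV_cong])
      have "(b - x) * (mode t x - top_coeff * (1 / (b - x))) = (b - x) * mode t x - top_coeff"
        using x by (simp add: right_diff_distrib)
      thus "- ((b - x) * mode t x) + lam * (exp (- (b * t)) * r t) - 0 =
          c t - (b - x) * (mode t x - top_coeff * (1 / (b - x)))"
        by (simp add: c_def)
    qed
    from DERIV_power[OF this, of 2]
    show "((\<lambda>t. (rest t x)\<^sup>2) has_real_derivative 2 * (c t * rest t x - (b - x) * (rest t x)\<^sup>2))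
        (at t within {0..})"
      by (simp add: algebra_simps power2_eq_square)
  next
    show "continuous_on ({0..} \<times> {- a..a}) (\<lambda>(t, x). 2 * (c t * rest t x - (b - x) * (rest t x)\<^sup>2))"
      unfolding c_def case_prod_unfold using continuous_rest[unfolded case_prod_unfold]
      by (intro continuous_intros continuous_on_compose2[OF cont_r]) auto
  qed (use t in \<open>auto intro!: continuous_intros continuous_slices\<close>)
  also have "sc_mean a (\<lambda>x. 2 * (c t * rest t x - (b - x) * (rest t x)\<^sup>2)) =
      2 * (c t * sc_mean a (rest t) - sc_mean a (\<lambda>x. (b - x) * (rest t x)\<^sup>2))"
    unfolding sc_mean_cmult using t
    by (subst sc_mean_diff) (auto intro!: continuous_intros continuous_slices simp: sc_mean_cmult)
  also have "c t = lam * sc_mean a (rest t)"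
    unfolding mean_rest[OF t] using lam_pos by (simp add: c_def right_diff_distrib)
  finally show ?thesis by (simp add: power2_eq_square mult.assoc)
qed

definition rate :: real where
  "rate = 2 * (1 - gap_ratio) * (b - a)"

lemma rate_pos: "0 < rate" using gap_ratio b_gt by (simp add: rate_def)

lemma energy_nonneg: "0 \<le> t \<Longrightarrow> 0 \<le> energy t"
  unfolding energy_def by (intro sc_mean_nonneg continuous_intros continuous_slices) auto

lemma continuous_energy: "continuous_on {0..} energy"
  using energy_deriv by (intro DERIV_continuous_on) auto

lemma energy_decay:
  assumes t: "0 \<le> t"
  shows "energy t \<le> energy 0 * exp (- (rate * t))"
proof -
  have "energy t * exp (rate * t) \<le> energy 0 * exp (rate * 0)"
  proof (rule DERIV_nonpos_imp_decreasing_open[OF t])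
    show "continuous_on {0..t} (\<lambda>t. energy t * exp (rate * t))"
      by (intro continuous_intros continuous_on_subset[OF continuous_energy]) auto
    fix s assume s: "0 < s" "s < t"
    define P where "P = sc_mean a (\<lambda>x. (b - x) * (rest s x)\<^sup>2)"
    have "(b - a) * energy s \<le> P"
      unfolding P_def energy_def sc_mean_cmult[symmetric] using s
      by (intro sc_mean_mono continuous_intros continuous_slices mult_right_mono) auto
    hence "rate * energy s \<le> 2 * (1 - gap_ratio) * P"
      using gap_ratio mult_left_mono[of "(b - a) * energy s" P "2 * (1 - gap_ratio)"]
      by (simp add: rate_def mult.assoc)
    hence le: "2 * (lam * (sc_mean a (rest s))\<^sup>2 - P) + rate * energy s \<le> 0"
      using rest_gap[of s] s by (simp add: P_def algebra_simps)
    have "at s within {0..} = at s" using s by (intro at_within_interior) auto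
    hence "(energy has_real_derivative 2 * (lam * (sc_mean a (rest s))\<^sup>2 - P)) (at s)"
      using energy_deriv[of s] s by (simp add: P_def)
    moreover have "((\<lambda>t. exp (rate * t)) has_real_derivative rate * exp (rate * s)) (at s)"
      by (auto intro!: derivative_eq_intros)
    ultimately have "((\<lambda>t. energy t * exp (rate * t)) has_real_derivative
        (2 * (lam * (sc_mean a (rest s))\<^sup>2 - P) + rate * energy s) * exp (rate * s)) (at s)"
      by (rule DERIV_mult[THEN DERIV_cong]) (simp add: algebra_simps)
    thus "\<exists>y. ((\<lambda>t. energy t * exp (rate * t)) has_real_derivative y) (at s) \<and> y \<le> 0"
      using le by (intro exI[of _ "_ * exp (rate * s)"] conjI mult_nonpos_nonneg) auto
  qed
  thus ?thesis by (simp add: exp_minus field_simps)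
qed

lemma energy_tendsto_0: "(energy \<longlongrightarrow> 0) at_top"
proof (rule tendsto_sandwich[OF _ _ tendsto_const])
  have "((\<lambda>t. energy 0 * exp (- (rate * t))) \<longlongrightarrow> energy 0 * 0) at_top"
    using rate_pos by (intro tendsto_intros filterlim_compose[OF exp_at_bot]
        filterlim_compose[OF filterlim_uminus_at_bot_at_top] filterlim_tendsto_pos_mult_at_top[OF tendsto_const]
        filterlim_ident)
  thus "((\<lambda>t. energy 0 * exp (- (rate * t))) \<longlongrightarrow> 0) at_top" by simp
qed (auto intro!: eventually_mono[OF eventually_ge_at_top[of 0]] energy_nonneg energy_decay)

lemma mean_rest_sq_le:
  assumes t: "0 \<le> t"
  shows "(exp (- (b * t)) * r t - top_coeff / lam)\<^sup>2 \<le> gap_ratio * (a + b) / lam * energy t"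
proof -
  have "lam * (sc_mean a (rest t))\<^sup>2 \<le> gap_ratio * sc_mean a (\<lambda>x. (b - x) * (rest t x)\<^sup>2)"
    by (rule rest_gap[OF t])
  also have "sc_mean a (\<lambda>x. (b - x) * (rest t x)\<^sup>2) \<le> (a + b) * energy t"
    unfolding energy_def sc_mean_cmult[symmetric] using t
    by (intro sc_mean_mono continuous_intros continuous_slices mult_right_mono) auto
  hence "gap_ratio * sc_mean a (\<lambda>x. (b - x) * (rest t x)\<^sup>2) \<le> gap_ratio * ((a + b) * energy t)"
    using gap_ratio by (intro mult_left_mono)
  finally show ?thesis
    using lam_pos by (simp add: mean_rest[OF t] pos_le_divide_eq mult.commute mult.left_commute)
qed

text \<open>
  The mean of \<open>rest\<close> is controlled by the energy through the spectral gap inequality itself.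
\<close>
lemma overlap_limit: "((\<lambda>t. exp (- (b * t)) * r t) \<longlongrightarrow> \<kappa> * (1 - a\<^sup>2 / (4 * lam\<^sup>2))) at_top"
proof -
  have "((\<lambda>t. (exp (- (b * t)) * r t - top_coeff / lam)\<^sup>2) \<longlongrightarrow> 0) at_top"
  proof (rule tendsto_sandwich[OF _ _ tendsto_const])
    show "((\<lambda>t. gap_ratio * (a + b) / lam * energy t) \<longlongrightarrow> 0) at_top"
      using tendsto_mult[OF tendsto_const energy_tendsto_0, of "gap_ratio * (a + b) / lam"] by simp
    show "\<forall>\<^sub>F t in at_top. (exp (- (b * t)) * r t - top_coeff / lam)\<^sup>2
        \<le> gap_ratio * (a + b) / lam * energy t"
      by (rule eventually_mono[OF eventually_ge_at_top[of 0] mean_rest_sq_le])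
  qed simp
  hence "((\<lambda>t. exp (- (b * t)) * r t - top_coeff / lam) \<longlongrightarrow> 0) at_top"
    using tendsto_real_sqrt[of _ 0] by (force simp: tendsto_rabs_zero_iff)
  from tendsto_add[OF this tendsto_const[of "top_coeff / lam"]]
  show ?thesis using lam_pos
    by (simp add: top_coeff_def field_simps power2_eq_square)
qed

lemma mean_mode_sq:
  assumes t: "0 \<le> t"
  shows "sc_mean a (\<lambda>x. (mode t x)\<^sup>2) = energy t + top_coeff\<^sup>2 / (lam\<^sup>2 - a\<^sup>2 / 4)"
proof -
  have c: "continuous_on {-a..a} (\<lambda>x. (rest t x)\<^sup>2)" "continuous_on {-a..a} (\<lambda>x. rest t x / (b - x))"
      "continuous_on {-a..a} (\<lambda>x. 1 / (b - x)\<^sup>2)"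
    using b_gt t by (auto intro!: continuous_intros continuous_slices)
  have "sc_mean a (\<lambda>x. (mode t x)\<^sup>2) =
      sc_mean a (\<lambda>x. 1 * (rest t x)\<^sup>2 + (2 * top_coeff) * (rest t x / (b - x)) + top_coeff\<^sup>2 * (1 / (b - x)\<^sup>2))"
  proof (rule sc_mean_cong)
    fix x
    have "mode t x = rest t x + top_coeff * (1 / (b - x))" by (simp add: rest_def)
    thus "(mode t x)\<^sup>2 = 1 * (rest t x)\<^sup>2 + (2 * top_coeff) * (rest t x / (b - x)) + top_coeff\<^sup>2 * (1 / (b - x)\<^sup>2)"
      by (simp add: power2_sum power_mult_distrib power_divide)
  qed
  also have "\<dots> = energy t + top_coeff\<^sup>2 / (lam\<^sup>2 - a\<^sup>2 / 4)"
    unfolding sc_mean_lincomb[OF c] rest_orthogonal[OF t] mean_top_sq energy_def by simp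
  finally show ?thesis .
qed

lemma mode_sq_limit:
  "((\<lambda>t. sc_mean a (\<lambda>x. (mode t x)\<^sup>2)) \<longlongrightarrow> \<kappa>\<^sup>2 * (1 - a\<^sup>2 / (4 * lam\<^sup>2))) at_top"
proof -
  have "((\<lambda>t. energy t + top_coeff\<^sup>2 / (lam\<^sup>2 - a\<^sup>2 / 4)) \<longlongrightarrow> 0 + top_coeff\<^sup>2 / (lam\<^sup>2 - a\<^sup>2 / 4)) at_top"
    by (intro tendsto_intros energy_tendsto_0)
  also have "0 + top_coeff\<^sup>2 / (lam\<^sup>2 - a\<^sup>2 / 4) = \<kappa>\<^sup>2 * (1 - a\<^sup>2 / (4 * lam\<^sup>2))"
    using lam_sq_gt lam_pos by (simp add: top_coeff_def power2_eq_square field_simps)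
  finally show ?thesis
    by (rule Lim_transform_eventually)
       (auto intro!: eventually_mono[OF eventually_ge_at_top[of 0]] simp: mean_mode_sq)
qed

text \<open>
  For \<open>\<kappa> = 0\<close> the energy vanishes at time \<open>0\<close>, hence always; this is uniqueness for the homogeneous equation.
\<close>
lemma overlap_zero:
  assumes "\<kappa> = 0" "0 \<le> t"
  shows "r t = 0"
proof -
  have "energy 0 = 0"
    unfolding energy_def rest_def mode_def memory_def top_coeff_def by (simp add: assms(1) sc_mean_def)
  hence "energy t = 0" using energy_decay[OF assms(2)] energy_nonneg[OF assms(2)] by simp
  moreover have "top_coeff = 0" unfolding top_coeff_def by (simp add: assms(1))
  ultimately show ?thesis using mean_rest_sq_le[OF assms(2)] by simp
qed

end

section \<open>The autocorrelation as a renewal equation\<close>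

text \<open>
  Here \<open>k(t) = K(t,t)/h(t)\<^sup>2\<close> and \<open>p = 1/h\<^sup>2\<close>. The relation \<open>p' = 2 k\<close> carries the whole feedback of the
  nonlinearity.
\<close>
locale noisy_dynamics =
  spiked_modes a lam b "\<rho> * sqrt lam" r for a lam b \<rho> r +
  fixes \<beta> :: real and k p :: "real \<Rightarrow> real"
  assumes \<beta>_pos: "0 < \<beta>" and \<rho>_nonneg: "0 \<le> \<rho>" and \<rho>_le_1: "\<rho> \<le> 1"
    and cont_k: "continuous_on {0..} k"
    and p_0: "p 0 = 1" and p_pos: "\<And>t. 0 \<le> t \<Longrightarrow> 0 < p t"
    and p_deriv: "\<And>t. 0 \<le> t \<Longrightarrow> (p has_real_derivative 2 * k t) (at t within {0..})"
    and k_eq: "\<And>t. 0 \<le> t \<Longrightarrow> k t =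
        1 / \<beta> * integral {0..t} (\<lambda>s. p s * sc_mean a (\<lambda>x. exp (x * (2 * (t - s)))))
      + sc_mean a (\<lambda>x. exp (x * (2 * t)))
      + 2 * (\<rho> * sqrt lam) * integral {0..t} (\<lambda>s. r s * sc_mean a (\<lambda>x. exp (x * (2 * t - s))))
      + lam * integral {0..t} (\<lambda>s1. integral {0..t} (\<lambda>s2.
          r s1 * r s2 * sc_mean a (\<lambda>x. exp (x * (2 * t - s1 - s2)))))"
begin

definition mgf2 :: "real \<Rightarrow> real" where
  "mgf2 t = sc_mean a (\<lambda>x. exp (x * (2 * t)))"

definition cum :: "real \<Rightarrow> real" where
  "cum t = integral {0..t} mgf2"

text \<open>
  The part of \<open>k\<close> that contains no noise. Completing the square in \<open>x\<close> splits it into the energy of the flow along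
  the spike and the variance \<open>1 - \<rho>\<^sup>2\<close> of the initial state uncorrelated with it; lemma \<open>source_eq\<close> recovers the
  terms of the original equation. Both parts are nonnegative as \<open>\<rho> \<le> 1\<close>.
\<close>
definition source :: "real \<Rightarrow> real" where
  "source t = exp (2 * b * t) * (sc_mean a (\<lambda>x. (mode t x)\<^sup>2) / lam) + (1 - \<rho>\<^sup>2) * mgf2 t"

definition noise_kernel :: "real \<Rightarrow> real" where
  "noise_kernel t = 2 / \<beta> * (exp (- (2 * b * t)) * cum t)"

text \<open>
  The limit of the integral of \<open>noise_kernel\<close>, see lemma \<open>noise_kernel_mass\<close>.
\<close>
definition mass :: real where
  "mass = 1 / \<beta> / (2 * lam * b)"

lemma b_pos: "0 < b" using a_pos b_gt by simp

lemma continuous_mgf2 [continuous_intros]: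
  "continuous_on S g \<Longrightarrow> continuous_on S (\<lambda>x. mgf2 (g x))"
proof -
  have "continuous_on UNIV mgf2"
    unfolding mgf2_def[abs_def]
    by (intro continuous_on_sc_mean, unfold case_prod_unfold) (intro continuous_intros)
  thus "continuous_on S g \<Longrightarrow> continuous_on S (\<lambda>x. mgf2 (g x))"
    by (rule continuous_on_compose2) auto
qed

lemma mgf2_nonneg: "0 \<le> mgf2 t"
  unfolding mgf2_def by (intro sc_mean_nonneg continuous_intros) auto

lemma mgf2_le: "0 \<le> t \<Longrightarrow> mgf2 t \<le> exp (2 * a * t) * sc_mean a (\<lambda>_. 1)"
  unfolding mgf2_def sc_mean_cmult[symmetric]
  by (intro sc_mean_mono continuous_intros) (auto simp: mult_right_mono)

lemma cum_deriv: "0 \<le> t \<Longrightarrow> (cum has_real_derivative mgf2 t) (at t within {0..})"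
  unfolding cum_def[abs_def] by (intro DERIV_integral_from_0 continuous_intros)

lemma continuous_cum: "continuous_on {0..} cum"
  using cum_deriv by (intro DERIV_continuous_on) auto

lemma cum_nonneg: "0 \<le> cum t"
  unfolding cum_def by (intro integral_nonneg integrable_continuous_real continuous_intros mgf2_nonneg)

lemma cum_le:
  assumes t: "0 \<le> t"
  shows "cum t \<le> t * (exp (2 * a * t) * sc_mean a (\<lambda>_. 1))"
proof -
  have "cum t \<le> integral {0..t} (\<lambda>_. exp (2 * a * t) * sc_mean a (\<lambda>_. 1))"
    unfolding cum_def
  proof (intro integral_le integrable_continuous_real continuous_intros)
    fix s assume s: "s \<in> {0..t}"
    have "0 \<le> sc_mean a (\<lambda>_. 1)" by (intro sc_mean_nonneg continuous_intros) auto
    hence "exp (2 * a * s) * sc_mean a (\<lambda>_. 1) \<le> exp (2 * a * t) * sc_mean a (\<lambda>_. 1)"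
      using s a_pos by (intro mult_right_mono) auto
    thus "mgf2 s \<le> exp (2 * a * t) * sc_mean a (\<lambda>_. 1)" using mgf2_le[of s] s by auto
  qed
  thus ?thesis using t by (simp add: mult_ac)
qed

lemma mgf2_decay: "((\<lambda>t. exp (- (2 * b * t)) * mgf2 t) \<longlongrightarrow> 0) at_top"
proof (rule tendsto_sandwich[OF _ _ tendsto_const])
  show "((\<lambda>t. exp (- (2 * (b - a) * t)) * sc_mean a (\<lambda>_. 1)) \<longlongrightarrow> 0) at_top"
    using tendsto_mult_left_zero[OF exp_decay[of "2 * (b - a)"]] b_gt by simp
  show "\<forall>\<^sub>F t in at_top. exp (- (2 * b * t)) * mgf2 t \<le> exp (- (2 * (b - a) * t)) * sc_mean a (\<lambda>_. 1)"
    using eventually_ge_at_top[of 0]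
  proof eventually_elim
    case (elim t)
    have "exp (- (2 * (b - a) * t)) = exp (- (2 * b * t)) * exp (2 * a * t)"
      by (simp add: exp_add[symmetric] algebra_simps)
    thus ?case using mgf2_le[OF elim] by (simp add: mult.assoc)
  qed
qed (simp add: mgf2_nonneg)

lemma cum_decay: "((\<lambda>t. exp (- (2 * b * t)) * cum t) \<longlongrightarrow> 0) at_top"
proof (rule tendsto_sandwich[OF _ _ tendsto_const])
  show "((\<lambda>t. t * exp (- (2 * (b - a) * t)) * sc_mean a (\<lambda>_. 1)) \<longlongrightarrow> 0) at_top"
    using tendsto_mult_left_zero[OF mult_exp_decay[of "2 * (b - a)"]] b_gt by simp
  show "\<forall>\<^sub>F t in at_top. exp (- (2 * b * t)) * cum t \<le> t * exp (- (2 * (b - a) * t)) * sc_mean a (\<lambda>_. 1)"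
    using eventually_ge_at_top[of 0]
  proof eventually_elim
    case (elim t)
    have "exp (- (2 * (b - a) * t)) = exp (- (2 * b * t)) * exp (2 * a * t)"
      by (simp add: exp_add[symmetric] algebra_simps)
    thus ?case
      using mult_left_mono[OF cum_le[OF elim], of "exp (- (2 * b * t))"] by (simp add: mult_ac)
  qed
qed (simp add: cum_nonneg)

lemma source_eq:
  assumes t: "0 \<le> t"
  shows "source t = mgf2 t
      + 2 * (\<rho> * sqrt lam) * integral {0..t} (\<lambda>s. r s * sc_mean a (\<lambda>x. exp (x * (2 * t - s))))
      + lam * integral {0..t} (\<lambda>s1. integral {0..t} (\<lambda>s2.
          r s1 * r s2 * sc_mean a (\<lambda>x. exp (x * (2 * t - s1 - s2)))))"
proof -
  have c: "continuous_on {-a..a} (\<lambda>x. exp (x * (2 * t)))"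
      "continuous_on {-a..a} (\<lambda>x. exp (x * (2 * t)) * memory t x)"
      "continuous_on {-a..a} (\<lambda>x. exp (x * (2 * t)) * memory t x * memory t x)"
    using t by (auto intro!: continuous_intros continuous_slices)
  have 1: "integral {0..t} (\<lambda>s. r s * sc_mean a (\<lambda>x. exp (x * (2 * t - s))))
      = sc_mean a (\<lambda>x. exp (x * (2 * t)) * memory t x)"
    using response_mean[OF t, of "\<lambda>_. 1" "2 * t"] by simp
  have "integral {0..t} (\<lambda>s1. integral {0..t} (\<lambda>s2.
          r s1 * r s2 * sc_mean a (\<lambda>x. exp (x * (2 * t - s1 - s2)))))
      = integral {0..t} (\<lambda>s1. r s1 * sc_mean a (\<lambda>x. exp (x * (2 * t - s1)) * memory t x))"
    using response_mean[OF t, of "\<lambda>_. 1"] by (simp add: mult.assoc)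
  also have "\<dots> = sc_mean a (\<lambda>x. exp (x * (2 * t)) * memory t x * memory t x)"
    by (intro response_mean t continuous_slices)
  finally have 2: "integral {0..t} (\<lambda>s1. integral {0..t} (\<lambda>s2.
      r s1 * r s2 * sc_mean a (\<lambda>x. exp (x * (2 * t - s1 - s2))))) = \<dots>" .
  have "exp (2 * b * t) * (sc_mean a (\<lambda>x. (mode t x)\<^sup>2) / lam)
      = sc_mean a (\<lambda>x. exp (2 * b * t) / lam * (mode t x)\<^sup>2)"
    by (subst sc_mean_cmult) simp
  also have "\<dots> = sc_mean a (\<lambda>x. \<rho>\<^sup>2 * exp (x * (2 * t)) + 2 * (\<rho> * sqrt lam) * (exp (x * (2 * t)) * memory t x)
      + lam * (exp (x * (2 * t)) * memory t x * memory t x))"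
  proof (rule sc_mean_cong)
    fix x
    have e: "exp (2 * b * t) * (exp (- ((b - x) * t)))\<^sup>2 = exp (x * (2 * t))"
      by (simp add: exp_add[symmetric] power2_eq_square algebra_simps)
    have "exp (2 * b * t) / lam * (mode t x)\<^sup>2 =
        (exp (2 * b * t) * (exp (- ((b - x) * t)))\<^sup>2) * ((\<rho> * sqrt lam + lam * memory t x)\<^sup>2 / lam)"
      by (simp add: mode_def power_mult_distrib)
    also have "(\<rho> * sqrt lam + lam * memory t x)\<^sup>2 / lam
        = \<rho>\<^sup>2 + 2 * (\<rho> * sqrt lam) * memory t x + lam * (memory t x * memory t x)"
    proof -
      have "(\<rho> * sqrt lam)\<^sup>2 = \<rho>\<^sup>2 * lam" using lam_pos by (simp add: power_mult_distrib)
      hence "(\<rho> * sqrt lam + lam * memory t x)\<^sup>2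
          = lam * (\<rho>\<^sup>2 + 2 * (\<rho> * sqrt lam) * memory t x + lam * (memory t x * memory t x))"
        unfolding power2_sum by (simp add: algebra_simps power2_eq_square)
      thus ?thesis using lam_pos by simp
    qed
    finally show "exp (2 * b * t) / lam * (mode t x)\<^sup>2 = \<rho>\<^sup>2 * exp (x * (2 * t))
        + 2 * (\<rho> * sqrt lam) * (exp (x * (2 * t)) * memory t x)
        + lam * (exp (x * (2 * t)) * memory t x * memory t x)"
      unfolding e by (simp add: algebra_simps)
  qed
  also have "\<dots> = \<rho>\<^sup>2 * mgf2 t + 2 * (\<rho> * sqrt lam) * sc_mean a (\<lambda>x. exp (x * (2 * t)) * memory t x)
      + lam * sc_mean a (\<lambda>x. exp (x * (2 * t)) * memory t x * memory t x)"
    unfolding mgf2_def by (rule sc_mean_lincomb[OF c])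
  finally show ?thesis unfolding source_def 1 2 by (simp add: algebra_simps)
qed

lemma source_nonneg: "0 \<le> t \<Longrightarrow> 0 \<le> source t"
  unfolding source_def using lam_pos \<rho>_nonneg \<rho>_le_1
  by (intro add_nonneg_nonneg mult_nonneg_nonneg divide_nonneg_pos sc_mean_nonneg mgf2_nonneg
      continuous_intros continuous_slices) (auto simp: power_le_one)

lemma source_limit:
  "((\<lambda>t. exp (- (2 * b * t)) * source t) \<longlongrightarrow> \<rho>\<^sup>2 * (1 - a\<^sup>2 / (4 * lam\<^sup>2))) at_top"
proof -
  have "((\<lambda>t. sc_mean a (\<lambda>x. (mode t x)\<^sup>2) / lam + (1 - \<rho>\<^sup>2) * (exp (- (2 * b * t)) * mgf2 t))
      \<longlongrightarrow> (\<rho> * sqrt lam)\<^sup>2 * (1 - a\<^sup>2 / (4 * lam\<^sup>2)) / lam + (1 - \<rho>\<^sup>2) * 0) at_top"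
    using lam_pos by (intro tendsto_intros mode_sq_limit mgf2_decay) auto
  moreover have "exp (- (2 * b * t)) * source t =
      sc_mean a (\<lambda>x. (mode t x)\<^sup>2) / lam + (1 - \<rho>\<^sup>2) * (exp (- (2 * b * t)) * mgf2 t)" for t
    by (simp add: source_def distrib_left exp_minus field_simps)
  ultimately show ?thesis using lam_pos by (simp add: power_mult_distrib)
qed

lemma k_eq_source: "0 \<le> t \<Longrightarrow> k t = 1 / \<beta> * integral {0..t} (\<lambda>s. p s * mgf2 (t - s)) + source t"
  using k_eq[of t] source_eq[of t] by (simp add: mgf2_def)

lemma continuous_p: "continuous_on {0..} p"
  using p_deriv by (intro DERIV_continuous_on) auto

lemma k_nonneg: "0 \<le> t \<Longrightarrow> 0 \<le> k t"
proof -
  assume t: "0 \<le> t"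
  have "continuous_on {0..t} (\<lambda>s. p s * mgf2 (t - s))"
    by (intro continuous_intros continuous_on_subset[OF continuous_p]) auto
  hence "0 \<le> integral {0..t} (\<lambda>s. p s * mgf2 (t - s))"
    using p_pos by (intro integral_nonneg integrable_continuous_real mult_nonneg_nonneg mgf2_nonneg)
      (auto intro: less_imp_le)
  thus ?thesis using source_nonneg[OF t] \<beta>_pos unfolding k_eq_source[OF t] by simp
qed

text \<open>
  Integration by parts with \<open>p' = 2 k\<close> and \<open>p 0 = 1\<close> eliminates \<open>p\<close> and leaves an equation in \<open>k\<close> alone.
\<close>
lemma noise_by_parts:
  assumes t: "0 \<le> t"
  shows "integral {0..t} (\<lambda>s. p s * mgf2 (t - s)) = cum t + 2 * integral {0..t} (\<lambda>s. cum s * k (t - s))"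
proof -
  have c: "continuous_on {0..t} (\<lambda>s. p s * mgf2 (t - s))" "continuous_on {0..t} (\<lambda>s. k s * cum (t - s))"
    by (intro continuous_intros continuous_on_subset[OF continuous_p] continuous_on_subset[OF cont_k]
        continuous_on_compose2[OF continuous_cum]; force)+
  have "((\<lambda>s. 2 * (k s * cum (t - s)) - p s * mgf2 (t - s)) has_integral
      p t * cum (t - t) - p 0 * cum (t - 0)) {0..t}"
  proof (rule fundamental_theorem_of_calculus_interior[OF t])
    show "continuous_on {0..t} (\<lambda>s. p s * cum (t - s))"
      by (intro continuous_intros continuous_on_subset[OF continuous_p]
          continuous_on_compose2[OF continuous_cum]) auto
    fix s assume s: "s \<in> {0<..<t}"
    have at: "at u within {0..} = at u" if "0 < u" for u :: real
      using that by (intro at_within_interior) auto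
    have "(p has_real_derivative 2 * k s) (at s)" using p_deriv[of s] at[of s] s by simp
    moreover have "((\<lambda>s. cum (t - s)) has_real_derivative mgf2 (t - s) * (0 - 1)) (at s)"
      using cum_deriv[of "t - s"] at[of "t - s"] s
      by (intro DERIV_chain2[of cum] DERIV_diff DERIV_const DERIV_ident) auto
    ultimately have "((\<lambda>s. p s * cum (t - s)) has_real_derivative
        2 * (k s * cum (t - s)) - p s * mgf2 (t - s)) (at s)"
      by (rule DERIV_mult[THEN DERIV_cong]) simp
    thus "((\<lambda>s. p s * cum (t - s)) has_vector_derivative 2 * (k s * cum (t - s)) - p s * mgf2 (t - s)) (at s)"
      by (simp add: has_real_derivative_iff_has_vector_derivative)
  qed
  hence "integral {0..t} (\<lambda>s. 2 * (k s * cum (t - s)) - p s * mgf2 (t - s)) = - cum t"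
    by (simp add: integral_unique p_0 cum_def)
  moreover have "integral {0..t} (\<lambda>s. 2 * (k s * cum (t - s)) - p s * mgf2 (t - s)) =
      2 * integral {0..t} (\<lambda>s. k s * cum (t - s)) - integral {0..t} (\<lambda>s. p s * mgf2 (t - s))"
    using Henstock_Kurzweil_Integration.integral_diff[OF integrable_continuous_real[OF
        continuous_on_mult[OF continuous_on_const c(2)]] integrable_continuous_real[OF c(1)], of 2]
    by simp
  moreover have "integral {0..t} (\<lambda>s. k s * cum (t - s)) = integral {0..t} (\<lambda>s. cum s * k (t - s))"
    using integral_reflect_interval[OF c(2)] by (simp add: mult.commute)
  ultimately show ?thesis by simp
qed

definition growth :: "real \<Rightarrow> real" where
  "growth t = exp (- (2 * b * t)) * k t"

definition forcing :: "real \<Rightarrow> real" where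
  "forcing t = 1 / \<beta> * (exp (- (2 * b * t)) * cum t) + exp (- (2 * b * t)) * source t"

text \<open>
  Multiplication by \<open>exp(-2 b t)\<close> is compatible with convolution: the weight splits as
  \<open>exp(-2 b s) exp(-2 b (t - s))\<close> between the kernel and the solution.
\<close>
lemma growth_volterra:
  assumes t: "0 \<le> t"
  shows "growth t = forcing t + integral {0..t} (\<lambda>s. noise_kernel s * growth (t - s))"
proof -
  have "noise_kernel s * growth (t - s) = 2 / \<beta> * exp (- (2 * b * t)) * (cum s * k (t - s))" for s
  proof -
    have "exp (- (2 * b * t)) = exp (- (2 * b * s)) * exp (- (2 * b * (t - s)))"
      by (simp add: exp_add[symmetric] algebra_simps)
    thus ?thesis by (simp add: noise_kernel_def growth_def)
  qed
  hence "integral {0..t} (\<lambda>s. noise_kernel s * growth (t - s)) =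
      2 / \<beta> * exp (- (2 * b * t)) * integral {0..t} (\<lambda>s. cum s * k (t - s))"
    by (simp only: integral_mult_right)
  thus ?thesis
    unfolding growth_def forcing_def k_eq_source[OF t] noise_by_parts[OF t] by (simp add: algebra_simps)
qed

lemma forcing_limit: "(forcing \<longlongrightarrow> \<rho>\<^sup>2 * (1 - a\<^sup>2 / (4 * lam\<^sup>2))) at_top"
  unfolding forcing_def[abs_def]
  using tendsto_add[OF tendsto_mult_right_zero[OF cum_decay] source_limit, of "1 / \<beta>"] by simp

lemma continuous_growth: "continuous_on {0..} growth"
  unfolding growth_def[abs_def] by (intro continuous_intros cont_k)

lemma continuous_noise_kernel: "continuous_on {0..} noise_kernel"
  unfolding noise_kernel_def[abs_def] by (intro continuous_intros continuous_cum)

lemma noise_kernel_nonneg: "0 \<le> noise_kernel t"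
  using \<beta>_pos by (simp add: noise_kernel_def cum_nonneg)

text \<open>
  The explicit integral at each \<open>x\<close> leaves the resolvent at \<open>b\<close>, whose mean is \<open>1/lam\<close>, and an exponentially
  small remainder.
\<close>
lemma integral_weighted_mgf2:
  assumes t: "0 \<le> t"
  shows "integral {0..t} (\<lambda>s. exp (- (2 * b * s)) * mgf2 s) =
    1 / (2 * lam) - 1 / 2 * sc_mean a (\<lambda>x. exp (- (2 * (b - x) * t)) * (1 / (b - x)))"
proof -
  have "exp (- (2 * b * s)) * mgf2 s = sc_mean a (\<lambda>x. exp (- (2 * (b - x) * s)))" for s
    unfolding mgf2_def sc_mean_cmult[symmetric]
    by (intro sc_mean_cong) (simp add: exp_add[symmetric] algebra_simps)
  hence "integral {0..t} (\<lambda>s. exp (- (2 * b * s)) * mgf2 s)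
      = integral {0..t} (\<lambda>s. sc_mean a (\<lambda>x. exp (- (2 * (b - x) * s))))" by simp
  also have "\<dots> = sc_mean a (\<lambda>x. integral {0..t} (\<lambda>s. exp (- (2 * (b - x) * s))))"
    by (intro sc_mean_swap, unfold case_prod_unfold) (intro continuous_intros)
  also have "\<dots> = sc_mean a (\<lambda>x. 1 / 2 * (1 / (b - x)) + (- (1 / 2)) * (exp (- (2 * (b - x) * t)) * (1 / (b - x)))
      + 0 * (1 / (b - x)))"
  proof (rule sc_mean_cong)
    fix x assume "x \<in> {-a..a}"
    hence x: "b - x > 0" using b_gt by auto
    define c where "c = 2 * (b - x)"
    have c: "c > 0" using x by (simp add: c_def)
    have "((\<lambda>s. exp (- (c * s))) has_integral - exp (- (c * t)) / c - - exp (- (c * 0)) / c) {0..t}"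
      using c by (intro fundamental_theorem_of_calculus t)
        (auto intro!: derivative_eq_intros simp flip: has_real_derivative_iff_has_vector_derivative)
    hence "integral {0..t} (\<lambda>s. exp (- (c * s))) = 1 / c - exp (- (c * t)) / c"
      by (simp add: integral_unique)
    thus "integral {0..t} (\<lambda>s. exp (- (2 * (b - x) * s))) = 1 / 2 * (1 / (b - x))
        + (- (1 / 2)) * (exp (- (2 * (b - x) * t)) * (1 / (b - x))) + 0 * (1 / (b - x))"
      by (simp add: c_def)
  qed
  also have "\<dots> = 1 / (2 * lam) - 1 / 2 * sc_mean a (\<lambda>x. exp (- (2 * (b - x) * t)) * (1 / (b - x)))"
  proof -
    have c: "continuous_on {-a..a} (\<lambda>x. exp (- (2 * (b - x) * t)) * (1 / (b - x)))"
      by (intro continuous_on_mult continuous_top continuous_intros)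
    show ?thesis unfolding sc_mean_lincomb[OF continuous_top c continuous_top] mean_top by simp
  qed
  finally show ?thesis .
qed

lemma integral_weighted_mgf2_limit:
  "((\<lambda>t. integral {0..t} (\<lambda>s. exp (- (2 * b * s)) * mgf2 s)) \<longlongrightarrow> 1 / (2 * lam)) at_top"
proof -
  define W where "W t = sc_mean a (\<lambda>x. exp (- (2 * (b - x) * t)) * (1 / (b - x)))" for t
  have c: "continuous_on {-a..a} (\<lambda>x. exp (- (2 * (b - x) * t)) * (1 / (b - x)))" for t
    by (intro continuous_on_mult continuous_top continuous_intros)
  have "(W \<longlongrightarrow> 0) at_top"
  proof (rule tendsto_sandwich[OF _ _ tendsto_const])
    show "((\<lambda>t. exp (- (2 * (b - a) * t)) * (1 / lam)) \<longlongrightarrow> 0) at_top"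
      using tendsto_mult_left_zero[OF exp_decay[of "2 * (b - a)"], of "1 / lam"] b_gt by simp
    show "\<forall>\<^sub>F t in at_top. 0 \<le> W t"
      unfolding W_def using b_gt by (intro always_eventually allI sc_mean_nonneg c) auto
    show "\<forall>\<^sub>F t in at_top. W t \<le> exp (- (2 * (b - a) * t)) * (1 / lam)"
      using eventually_ge_at_top[of 0]
    proof eventually_elim
      case (elim t)
      show ?case
        unfolding W_def mean_top[symmetric] sc_mean_cmult[symmetric] using b_gt elim
        by (intro sc_mean_mono c continuous_on_mult continuous_top continuous_on_const mult_right_mono)
          (auto simp: mult_right_mono)
    qed
  qed
  hence "((\<lambda>t. 1 / (2 * lam) - 1 / 2 * W t) \<longlongrightarrow> 1 / (2 * lam) - 1 / 2 * 0) at_top"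
    by (intro tendsto_intros)
  hence "((\<lambda>t. 1 / (2 * lam) - 1 / 2 * W t) \<longlongrightarrow> 1 / (2 * lam)) at_top" by simp
  thus ?thesis
    by (rule Lim_transform_eventually)
       (auto intro!: eventually_mono[OF eventually_ge_at_top[of 0]] simp: integral_weighted_mgf2 W_def)
qed

text \<open>
  Since \<open>cum\<close> is a primitive of \<open>mgf2\<close>, one integration by parts reduces the integral to the previous one
  and divides it by \<open>2 b\<close>.
\<close>
lemma noise_kernel_mass: "((\<lambda>t. integral {0..t} noise_kernel) \<longlongrightarrow> mass) at_top"
proof -
  define J where "J t = exp (- (2 * b * t)) * cum t" for t
  define I where "I t = integral {0..t} (\<lambda>s. exp (- (2 * b * s)) * mgf2 s)" for t
  have eq: "integral {0..t} noise_kernel = 1 / (\<beta> * b) * (I t - J t)" if t: "0 \<le> t" for t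
  proof -
    have cJ: "continuous_on {0..t} J"
      unfolding J_def by (intro continuous_intros continuous_on_subset[OF continuous_cum]) auto
    have cm: "continuous_on {0..t} (\<lambda>s. exp (- (2 * b * s)) * mgf2 s)" by (intro continuous_intros)
    have "((\<lambda>s. exp (- (2 * b * s)) * mgf2 s - 2 * b * J s) has_integral J t - J 0) {0..t}"
    proof (rule fundamental_theorem_of_calculus_interior[OF t cJ])
      fix s assume s: "s \<in> {0<..<t}"
      have "at s within {0..} = at s" using s by (intro at_within_interior) auto
      hence "(cum has_real_derivative mgf2 s) (at s)" using cum_deriv[of s] s by simp
      hence "((\<lambda>s. exp (- (2 * b * s)) * cum s) has_real_derivative
          exp (- (2 * b * s)) * - (2 * b) * cum s + mgf2 s * exp (- (2 * b * s))) (at s)"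
        by (intro DERIV_mult DERIV_chain2[OF DERIV_exp]) (auto intro!: derivative_eq_intros)
      hence "(J has_real_derivative exp (- (2 * b * s)) * mgf2 s - 2 * b * J s) (at s)"
        unfolding J_def by (rule DERIV_cong) (simp add: algebra_simps)
      thus "(J has_vector_derivative exp (- (2 * b * s)) * mgf2 s - 2 * b * J s) (at s)"
        by (simp add: has_real_derivative_iff_has_vector_derivative)
    qed
    hence "J t = integral {0..t} (\<lambda>s. exp (- (2 * b * s)) * mgf2 s - 2 * b * J s)"
      by (simp add: integral_unique J_def cum_def)
    also have "\<dots> = I t - 2 * b * integral {0..t} J"
      using Henstock_Kurzweil_Integration.integral_diff[OF integrable_continuous_real[OF cm]
        integrable_continuous_real[OF continuous_on_mult[OF continuous_on_const cJ]], of "2 * b"]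
      by (simp add: I_def)
    finally have "2 * b * integral {0..t} J = I t - J t" by simp
    moreover have "integral {0..t} noise_kernel = 2 / \<beta> * integral {0..t} J"
      unfolding noise_kernel_def[abs_def] J_def by (simp only: integral_mult_right)
    moreover have "2 / \<beta> * integral {0..t} J = 1 / (\<beta> * b) * (2 * b * integral {0..t} J)"
      using b_pos by simp
    ultimately show ?thesis by (simp only:)
  qed
  have "((\<lambda>t. 1 / (\<beta> * b) * (I t - J t)) \<longlongrightarrow> 1 / (\<beta> * b) * (1 / (2 * lam) - 0)) at_top"
    unfolding I_def J_def by (intro tendsto_intros integral_weighted_mgf2_limit cum_decay)
  hence "((\<lambda>t. 1 / (\<beta> * b) * (I t - J t)) \<longlongrightarrow> mass) at_top"
    by (simp add: mass_def mult_ac)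
  thus ?thesis
    by (rule Lim_transform_eventually)
       (auto intro!: eventually_mono[OF eventually_ge_at_top[of 0]] simp: eq)
qed

lemma overlap_ratio: "(r t)\<^sup>2 / (lam * k t) = (exp (- (b * t)) * r t)\<^sup>2 / (lam * growth t)"
proof -
  have "(exp (- (b * t)))\<^sup>2 = exp (- (2 * b * t))"
    by (simp add: power2_eq_square exp_add[symmetric])
  thus ?thesis by (simp add: growth_def power_mult_distrib)
qed

lemma spike_weight_pos: "0 < 1 - a\<^sup>2 / (4 * lam\<^sup>2)"
  using lam_sq_gt lam_pos by (simp add: field_simps)

lemma ratio_limit_uncorrelated: "\<rho> = 0 \<Longrightarrow> ((\<lambda>t. (r t)\<^sup>2 / (lam * k t)) \<longlongrightarrow> 0) at_top"
  by (rule Lim_transform_eventually[OF tendsto_const])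
     (auto intro!: eventually_mono[OF eventually_ge_at_top[of 0]] simp: overlap_zero)

lemma ratio_limit_supercritical:
  assumes "0 < \<rho>" "1 < mass"
  shows "((\<lambda>t. (r t)\<^sup>2 / (lam * k t)) \<longlongrightarrow> 0) at_top"
proof -
  have "filterlim growth at_top at_top"
    by (rule volterra_supercritical[OF continuous_noise_kernel noise_kernel_nonneg continuous_growth _
          growth_volterra forcing_limit _ noise_kernel_mass])
       (use assms spike_weight_pos k_nonneg in \<open>auto simp: growth_def\<close>)
  hence "filterlim (\<lambda>t. lam * growth t) at_top at_top"
    by (intro filterlim_tendsto_pos_mult_at_top[OF tendsto_const lam_pos])
  hence "filterlim (\<lambda>t. lam * growth t) at_infinity at_top"
    by (rule filterlim_mono[OF _ at_top_le_at_infinity order_refl])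
  thus ?thesis
    unfolding overlap_ratio by (intro tendsto_divide_0[OF tendsto_power[OF overlap_limit]])
qed

lemma ratio_limit_subcritical:
  assumes "0 < \<rho>" "mass < 1"
  shows "((\<lambda>t. (r t)\<^sup>2 / (lam * k t)) \<longlongrightarrow> (1 - mass) * (1 - a\<^sup>2 / (4 * lam\<^sup>2))) at_top"
proof -
  define c where "c = 1 - a\<^sup>2 / (4 * lam\<^sup>2)"
  have c: "c > 0" using spike_weight_pos by (simp add: c_def)
  have "(growth \<longlongrightarrow> \<rho>\<^sup>2 * c / (1 - mass)) at_top"
    unfolding c_def
    by (rule volterra_subcritical[OF continuous_noise_kernel noise_kernel_nonneg continuous_growth
          growth_volterra forcing_limit noise_kernel_mass assms(2)]) auto
  hence "((\<lambda>t. (r t)\<^sup>2 / (lam * k t)) \<longlongrightarrow>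
      (\<rho> * sqrt lam * c)\<^sup>2 / (lam * (\<rho>\<^sup>2 * c / (1 - mass)))) at_top"
    unfolding overlap_ratio using c assms lam_pos
    by (intro tendsto_divide tendsto_power tendsto_mult[OF tendsto_const[of lam]]
        overlap_limit[folded c_def]) auto
  also have "(\<rho> * sqrt lam * c)\<^sup>2 / (lam * (\<rho>\<^sup>2 * c / (1 - mass))) = (1 - mass) * c"
  proof -
    have "(\<rho> * sqrt lam * c)\<^sup>2 = \<rho>\<^sup>2 * lam * c\<^sup>2" using lam_pos by (simp add: power_mult_distrib)
    thus ?thesis using assms c lam_pos by (simp only: power2_eq_square) simp
  qed
  finally show ?thesis by (simp add: c_def)
qed

end

section \<open>Linearising the limiting dynamics\<close>

text \<open>
  The predicate \<^term>\<open>indep_var\<close> relates two random variables with values in one type. Independence of a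
  real variable and a pair, given through the generated sigma-algebras, reaches it through a real function
  \<open>g\<close> of the pair.
\<close>
lemma (in prob_space) indep_var_of_vimage_algebra:
  assumes [measurable]: "X \<in> measurable M S" "Y \<in> measurable M T" "g \<in> measurable T S"
    and indep: "indep_set (sets (vimage_algebra (space M) X S)) (sets (vimage_algebra (space M) Y T))"
  shows "indep_var S X S (\<lambda>\<omega>. g (Y \<omega>))"
proof -
  have "sigma_sets (space M) {(\<lambda>\<omega>. g (Y \<omega>)) -` A \<inter> space M |A. A \<in> sets S}
      \<subseteq> sets (vimage_algebra (space M) Y T)"
  proof (intro sets.sigma_sets_subset[of _ "vimage_algebra (space M) Y T", simplified] subsetI)
    fix B assume "B \<in> {(\<lambda>\<omega>. g (Y \<omega>)) -` A \<inter> space M |A. A \<in> sets S}"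
    then obtain A where A: "A \<in> sets S" "B = (\<lambda>\<omega>. g (Y \<omega>)) -` A \<inter> space M" by auto
    have "B = Y -` (g -` A \<inter> space T) \<inter> space M"
      using A(2) measurable_space[OF assms(2)] by auto
    moreover have "g -` A \<inter> space T \<in> sets T" using A(1) by measurable
    ultimately show "B \<in> sets (vimage_algebra (space M) Y T)" by (simp only: in_vimage_algebra)
  qed
  hence "indep_set (sigma_sets (space M) {X -` A \<inter> space M |A. A \<in> sets S})
      (sigma_sets (space M) {(\<lambda>\<omega>. g (Y \<omega>)) -` A \<inter> space M |A. A \<in> sets S})"
    using indep unfolding indep_set_def sets_vimage_algebra
    by (intro indep_sets_mono_sets[OF indep[unfolded indep_set_def sets_vimage_algebra]])
      (auto split: bool.split)
  thus ?thesis by (simp add: indep_var_eq)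
qed

lemma (in prob_space) expectation_semicircle_times:
  assumes [measurable]: "\<sigma> \<in> borel_measurable M" "Y \<in> measurable M T" "g \<in> borel_measurable T"
    and law: "distr M borel \<sigma> = semicircle_law a"
    and indep: "indep_set (sets (vimage_algebra (space M) \<sigma> borel)) (sets (vimage_algebra (space M) Y T))"
    and int: "has_bochner_integral M (\<lambda>\<omega>. g (Y \<omega>)) c"
    and [measurable]: "\<phi> \<in> borel_measurable borel" and cont: "continuous_on {-a..a} \<phi>"
  shows "(\<integral>\<omega>. \<phi> (\<sigma> \<omega>) * g (Y \<omega>) \<partial>M) = sc_mean a \<phi> * c"
proof -
  have iv: "indep_var borel (\<lambda>\<omega>. \<phi> (\<sigma> \<omega>)) borel (\<lambda>\<omega>. g (Y \<omega>))"
    using indep_var_compose[OF indep_var_of_vimage_algebra[OF assms(1-3) indep] assms(7) measurable_ident]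
    by (simp add: o_def)
  have i: "integrable M (\<lambda>\<omega>. \<phi> (\<sigma> \<omega>))"
    using integrable_semicircle_law[OF assms(7) cont] unfolding law[symmetric]
    by (subst (asm) integrable_distr_eq) auto
  have "(\<integral>\<omega>. \<phi> (\<sigma> \<omega>) * g (Y \<omega>) \<partial>M) = (\<integral>\<omega>. \<phi> (\<sigma> \<omega>) \<partial>M) * (\<integral>\<omega>. g (Y \<omega>) \<partial>M)"
    by (rule indep_var_lebesgue_integral[OF iv i])
      (use int in \<open>simp add: has_bochner_integral_iff\<close>)
  also have "(\<integral>\<omega>. \<phi> (\<sigma> \<omega>) \<partial>M) = (\<integral>x. \<phi> x \<partial>semicircle_law a)"
    unfolding law[symmetric] by (rule integral_distr[symmetric]) auto
  also have "\<dots> = sc_mean a \<phi>" by (rule integral_semicircle_law[OF assms(7) cont])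
  finally show ?thesis using int by (simp add: has_bochner_integral_iff)
qed

text \<open>
  Independence turns all expectations into multiples of \<open>m\<close>, and \<open>H(s,t) = h(t)/h(s)\<close>; dividing the equations
  by \<open>h(t)\<close> and by \<open>h(t)\<^sup>2\<close> then removes \<open>K\<close> from the kernels, except through \<open>p\<close>.
\<close>
lemma noisy_dynamics_of_limit_dynamics:
  fixes M :: "'a measure" and u \<sigma> Y0 :: "'a \<Rightarrow> real"
  assumes a: "0 < a" and \<beta>: "0 < \<beta>" and \<rho>: "0 \<le> \<rho>" "\<rho> \<le> 1" and lam: "a / 2 < lam"
    and "prob_space M"
    and meas [measurable]: "u \<in> borel_measurable M" "\<sigma> \<in> borel_measurable M" "Y0 \<in> borel_measurable M"
    and law: "distr M borel \<sigma> = semicircle_law a"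
    and indep: "prob_space.indep_set M
           (sets (vimage_algebra (space M) \<sigma> borel))
           (sets (vimage_algebra (space M) (\<lambda>\<omega>. (u \<omega>, Y0 \<omega>)) (borel \<Otimes>\<^sub>M borel)))"
    and uu: "has_bochner_integral M (\<lambda>\<omega>. (u \<omega>)\<^sup>2) lam"
    and YY: "has_bochner_integral M (\<lambda>\<omega>. (Y0 \<omega>)\<^sup>2) 1"
    and uY: "has_bochner_integral M (\<lambda>\<omega>. u \<omega> * Y0 \<omega>) (\<rho> * sqrt lam)"
    and dyn: "limit_dynamics M u \<sigma> Y0 (\<lambda>x. x\<^sup>2 / 2) \<beta> R K"
  defines "h \<equiv> \<lambda>t. exp (- integral {0..t} (\<lambda>s. K s s))"
  shows "noisy_dynamics a lam (lam + a\<^sup>2 / (4 * lam)) \<rho> (\<lambda>t. R t / h t) \<beta>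
    (\<lambda>t. K t t / (h t)\<^sup>2) (\<lambda>t. 1 / (h t)\<^sup>2)"
proof -
  interpret prob_space M by fact
  have deriv_f: "deriv (\<lambda>x::real. x\<^sup>2 / 2) x = x" for x
    by (rule DERIV_imp_deriv) (auto intro!: derivative_eq_intros)
  have contK: "continuous_on {0..} (\<lambda>t. K t t)"
  proof -
    have "continuous_on ({0..} \<times> {0..}) (\<lambda>(t, s). K t s)" using dyn by (simp add: limit_dynamics_def)
    moreover have "continuous_on {0..} (\<lambda>t::real. (t, t))" by (intro continuous_intros)
    ultimately show ?thesis
      using continuous_on_compose2[of "{0..} \<times> {0..}" "\<lambda>(t, s). K t s" "{0..}" "\<lambda>t. (t, t)"] by auto
  qed
  have contR: "continuous_on {0..} R" using dyn by (simp add: limit_dynamics_def)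
  have h0: "0 < h t" for t by (simp add: h_def)
  note dI = DERIV_integral_from_0[OF contK]
  have conth: "continuous_on {0..} h"
    unfolding h_def using dI by (intro continuous_intros DERIV_continuous_on) auto
  define H where "H = H_kernel (\<lambda>x. x\<^sup>2 / 2) K"
  have H_eq: "H s t = h t / h s" if "0 \<le> s" "s \<le> t" for s t
  proof -
    have "integral {0..s} (\<lambda>r. K r r) + integral {s..t} (\<lambda>r. K r r) = integral {0..t} (\<lambda>r. K r r)"
      using that by (intro Henstock_Kurzweil_Integration.integral_combine integrable_continuous_real
          continuous_on_subset[OF contK]) auto
    thus ?thesis by (simp add: H_def H_kernel_def deriv_f h_def exp_diff[symmetric])
  qed
  have h00: "h 0 = 1" by (simp add: h_def)
  define m where "m \<tau> = sc_mean a (\<lambda>x. exp (x * \<tau>))" for \<tau>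
  have cexp: "continuous_on {-a..a} (\<lambda>x. exp (x * \<tau>))" for \<tau> by (intro continuous_intros)
  have E: "(\<integral>\<omega>. exp (\<sigma> \<omega> * \<tau>) * g (u \<omega>, Y0 \<omega>) \<partial>M) = m \<tau> * c"
    if [measurable]: "g \<in> borel_measurable (borel \<Otimes>\<^sub>M borel)"
      and "has_bochner_integral M (\<lambda>\<omega>. g (u \<omega>, Y0 \<omega>)) c" for g c \<tau>
    unfolding m_def
    by (rule expectation_semicircle_times[OF meas(2) _ that(1) law indep that(2) _ cexp]) measurable
  have g: "(\<lambda>_::real \<times> real. 1::real) \<in> borel_measurable (borel \<Otimes>\<^sub>M borel)"
      "(\<lambda>p::real \<times> real. (fst p)\<^sup>2) \<in> borel_measurable (borel \<Otimes>\<^sub>M borel)"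
      "(\<lambda>p::real \<times> real. (snd p)\<^sup>2) \<in> borel_measurable (borel \<Otimes>\<^sub>M borel)"
      "(\<lambda>p::real \<times> real. fst p * snd p) \<in> borel_measurable (borel \<Otimes>\<^sub>M borel)"
    by measurable
  have one: "has_bochner_integral M (\<lambda>_. 1::real) 1"
    by (simp add: has_bochner_integral_iff prob_space)
  have E1: "(\<integral>\<omega>. exp (\<sigma> \<omega> * \<tau>) \<partial>M) = m \<tau>" for \<tau>
    using E[OF g(1) one, of \<tau>] by simp
  have Eu: "(\<integral>\<omega>. exp (\<sigma> \<omega> * \<tau>) * (u \<omega>)\<^sup>2 \<partial>M) = m \<tau> * lam" for \<tau>
    using E[OF g(2), unfolded fst_conv, OF uu] .
  have EY: "(\<integral>\<omega>. exp (\<sigma> \<omega> * \<tau>) * (Y0 \<omega>)\<^sup>2 \<partial>M) = m \<tau>" for \<tau>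
    using E[OF g(3), unfolded snd_conv, OF YY, of \<tau>] by simp
  have EuY: "(\<integral>\<omega>. exp (\<sigma> \<omega> * \<tau>) * Y0 \<omega> * u \<omega> \<partial>M) = m \<tau> * (\<rho> * sqrt lam)" for \<tau>
    using E[OF g(4), unfolded fst_conv snd_conv, OF uY, of \<tau>] by (simp only: mult_ac)
  show ?thesis
  proof unfold_locales
    show "0 < a" "a / 2 < lam" "0 < \<beta>" "0 \<le> \<rho>" "\<rho> \<le> 1" by fact+
    show "continuous_on {0..} (\<lambda>t. R t / h t)"
      using h0 by (intro continuous_intros contR conth) (auto simp: less_imp_neq[symmetric])
    show "continuous_on {0..} (\<lambda>t. K t t / (h t)\<^sup>2)"
      using h0 by (intro continuous_intros contK conth) (auto simp: less_imp_neq[symmetric])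
    show "1 / (h 0)\<^sup>2 = 1" by (simp add: h00)
    fix t :: real assume t: "0 \<le> t"
    show "0 < 1 / (h t)\<^sup>2" using h0[of t] by simp
    have p: "1 / (h t)\<^sup>2 = exp (2 * integral {0..t} (\<lambda>s. K s s))" for t
      by (simp add: h_def exp_minus power2_eq_square exp_add[symmetric] divide_inverse)
    have "((\<lambda>t. exp (2 * integral {0..t} (\<lambda>s. K s s))) has_real_derivative
        exp (2 * integral {0..t} (\<lambda>s. K s s)) * (2 * K t t)) (at t within {0..})"
      by (intro DERIV_chain2[OF DERIV_exp] DERIV_cmult dI t)
    hence "((\<lambda>t. 1 / (h t)\<^sup>2) has_real_derivative 1 / (h t)\<^sup>2 * (2 * K t t)) (at t within {0..})"
      unfolding p .
    thus "((\<lambda>t. 1 / (h t)\<^sup>2) has_real_derivative 2 * (K t t / (h t)\<^sup>2)) (at t within {0..})"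
      by simp
    have "R t = h t * (m t * (\<rho> * sqrt lam))
        + integral {0..t} (\<lambda>s. H s t * R s * (m (t - s) * lam))"
      using dyn t by (simp add: limit_dynamics_def R_equation_def Let_def EuY Eu H_eq h00 flip: H_def)
    also have "integral {0..t} (\<lambda>s. H s t * R s * (m (t - s) * lam))
        = integral {0..t} (\<lambda>s. (h t * lam) * (R s / h s * m (t - s)))"
      by (intro integral_cong) (simp add: H_eq)
    also have "\<dots> = (h t * lam) * integral {0..t} (\<lambda>s. R s / h s * m (t - s))"
      by (rule integral_mult_right)
    finally show "R t / h t = \<rho> * sqrt lam * sc_mean a (\<lambda>x. exp (x * t))
        + lam * integral {0..t} (\<lambda>s. R s / h s * sc_mean a (\<lambda>x. exp (x * (t - s))))"
      using h0[of t] by (simp add: m_def field_simps)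
    have "K t t = 1 / \<beta> * integral {0..t} (\<lambda>s. H s t * H s t * m (t + t - 2 * s))
        + h t * h t * m (t + t)
        + h t * integral {0..t} (\<lambda>s. H s t * R s * (m (t + t - s) * (\<rho> * sqrt lam)))
        + h t * integral {0..t} (\<lambda>s. H s t * R s * (m (t + t - s) * (\<rho> * sqrt lam)))
        + integral {0..t} (\<lambda>s1. integral {0..t} (\<lambda>s2.
            H s1 t * H s2 t * R s1 * R s2 * (m (t + t - s1 - s2) * lam)))"
      using dyn t by (simp add: limit_dynamics_def K_equation_def Let_def EuY Eu EY E1 H_eq h00 flip: H_def)
    also have "integral {0..t} (\<lambda>s. H s t * H s t * m (t + t - 2 * s))
        = integral {0..t} (\<lambda>s. (h t)\<^sup>2 * (1 / (h s)\<^sup>2 * m (2 * (t - s))))"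
      by (intro integral_cong) (simp add: H_eq power2_eq_square algebra_simps)
    also have "\<dots> = (h t)\<^sup>2 * integral {0..t} (\<lambda>s. 1 / (h s)\<^sup>2 * m (2 * (t - s)))"
      by (rule integral_mult_right)
    also have "integral {0..t} (\<lambda>s. H s t * R s * (m (t + t - s) * (\<rho> * sqrt lam)))
        = integral {0..t} (\<lambda>s. (h t * (\<rho> * sqrt lam)) * (R s / h s * m (2 * t - s)))"
      by (intro integral_cong) (simp add: H_eq algebra_simps)
    also have "\<dots> = (h t * (\<rho> * sqrt lam)) * integral {0..t} (\<lambda>s. R s / h s * m (2 * t - s))"
      by (rule integral_mult_right)
    also have "integral {0..t} (\<lambda>s1. integral {0..t} (\<lambda>s2.
            H s1 t * H s2 t * R s1 * R s2 * (m (t + t - s1 - s2) * lam)))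
        = integral {0..t} (\<lambda>s1. integral {0..t} (\<lambda>s2.
            ((h t)\<^sup>2 * lam) * (R s1 / h s1 * (R s2 / h s2) * m (2 * t - s1 - s2))))"
      by (intro integral_cong) (simp add: H_eq power2_eq_square algebra_simps)
    also have "\<dots> = ((h t)\<^sup>2 * lam) * integral {0..t} (\<lambda>s1. integral {0..t} (\<lambda>s2.
            R s1 / h s1 * (R s2 / h s2) * m (2 * t - s1 - s2)))"
      by (simp only: integral_mult_right)
    finally show "K t t / (h t)\<^sup>2 =
        1 / \<beta> * integral {0..t} (\<lambda>s. 1 / (h s)\<^sup>2 * sc_mean a (\<lambda>x. exp (x * (2 * (t - s)))))
      + sc_mean a (\<lambda>x. exp (x * (2 * t)))
      + 2 * (\<rho> * sqrt lam) * integral {0..t} (\<lambda>s. R s / h s * sc_mean a (\<lambda>x. exp (x * (2 * t - s))))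
      + lam * integral {0..t} (\<lambda>s1. integral {0..t} (\<lambda>s2.
          R s1 / h s1 * (R s2 / h s2) * sc_mean a (\<lambda>x. exp (x * (2 * t - s1 - s2)))))"
      using h0[of t] unfolding m_def[symmetric] by (simp add: field_simps power2_eq_square)
  qed auto
qed

theorem theorem1p2:
  fixes M :: "'a measure" and u \<sigma> Y0 :: "'a \<Rightarrow> real"
    and \<sigma>star \<beta> \<rho> lam lamt :: real
    and f R :: "real \<Rightarrow> real" and K :: "real \<Rightarrow> real \<Rightarrow> real"
  assumes "\<sigma>star > 0" and "\<beta> > 0" and "0 \<le> \<rho>" and "\<rho> \<le> 1" and "lam > 0"
    and "f = (\<lambda>x. x\<^sup>2 / 2)"
    and "prob_space M"
    and "u \<in> borel_measurable M" and "\<sigma> \<in> borel_measurable M" and "Y0 \<in> borel_measurable M"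
    and "distr M borel \<sigma> = semicircle_law \<sigma>star"
    and "prob_space.indep_set M
           (sets (vimage_algebra (space M) \<sigma> borel))
           (sets (vimage_algebra (space M) (\<lambda>\<omega>. (u \<omega>, Y0 \<omega>)) (borel \<Otimes>\<^sub>M borel)))"
    and "has_bochner_integral M (\<lambda>\<omega>. (u \<omega>)\<^sup>2) lam"
    and "has_bochner_integral M (\<lambda>\<omega>. (Y0 \<omega>)\<^sup>2) 1"
    and "has_bochner_integral M (\<lambda>\<omega>. u \<omega> * Y0 \<omega>) (\<rho> * sqrt lam)"
    and "limit_dynamics M u \<sigma> Y0 f \<beta> R K"
    and "lam > \<sigma>star / 2"
    and "lamt = lam + \<sigma>star\<^sup>2 / (4 * lam)"
  shows "(\<beta> < 1 / \<sigma>star\<^sup>2 \<longrightarrow> card (critical_roots \<sigma>star \<beta>) = 2) \<and>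
    (2 * lamt < s_crit \<sigma>star \<beta> \<or> \<rho> = 0 \<longrightarrow>
      ((\<lambda>t. (R t)\<^sup>2 / (lam * K t t)) \<longlongrightarrow> 0) at_top) \<and>
    (2 * lamt > s_crit \<sigma>star \<beta> \<and> \<rho> > 0 \<longrightarrow>
      ((\<lambda>t. (R t)\<^sup>2 / (lam * K t t)) \<longlongrightarrow>
        (1 - (1 / \<beta>) / (2 * lam * (lam + \<sigma>star\<^sup>2 / (4 * lam)))) *
        (1 - \<sigma>star\<^sup>2 / (4 * lam\<^sup>2))) at_top)"
proof -
  define h where "h t = exp (- integral {0..t} (\<lambda>s. K s s))" for t
  interpret noisy_dynamics \<sigma>star lam "lam + \<sigma>star\<^sup>2 / (4 * lam)" \<rho> "\<lambda>t. R t / h t" \<beta>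
    "\<lambda>t. K t t / (h t)\<^sup>2" "\<lambda>t. 1 / (h t)\<^sup>2"
    unfolding h_def using assms by (intro noisy_dynamics_of_limit_dynamics) auto
  have h: "h t \<noteq> 0" for t by (simp add: h_def)
  have ratio: "(R t / h t)\<^sup>2 / (lam * (K t t / (h t)\<^sup>2)) = (R t)\<^sup>2 / (lam * K t t)" for t
    using h[of t] by (simp add: power_divide)
  note cmp = s_crit_compare[OF assms(1,2) assms(17) refl, folded mass_def]
  show ?thesis
    using card_critical_roots[OF assms(1,2)] cmp ratio_limit_uncorrelated
      ratio_limit_supercritical ratio_limit_subcritical assms(3)
    unfolding ratio assms(18) mass_def by (cases "\<rho> = 0") auto
qed

end
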